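(* Let $(X,d,\mu)$ be a totally bounded metric measure space such that $\mu$ is lower Ahlfors $Q(\cdot)$-regular for some $Q\in\mathcal{P}_b^{\log}(X)$. Fix $p,s\in\mathcal{P}_b^{\log}(X)$ such that $sp\ll Q$. Then we have the compact embedding $$M^{s(\cdot),p(\cdot)}(X,d,\mu)\hookrightarrow\hookrightarrow L^{q(\cdot)}(X,\mu)$$ for every $q\in\mathcal{P}_b(X)$ such that $p\le q\ll\gamma$, where $\gamma:=Qp/(Q-sp)$.
   Context: A metric measure space $(X,d,\mu)$ is a metric space $(X,d)$ with a Borel measure $\mu$ such that $0<\mu(B(x,r))<\infty$ for every open ball $B(x,r)$, $x\in X$, $r\in(0,\infty)$ (in particular $X$ is separable). Exponents: for measurable $p$ on $X$, $p^+=\operatorname{ess\,sup}_X p$, $p^-=\operatorname{ess\,inf}_X p$. $\mathcal{P}(X)$ is the set of measurable $p:X\to(0,\infty]$ with $p^->0$; $\mathcal{P}_b(X)=\mathcal{P}(X)\cap L^\infty(X,\mu)$. $p_1\ll p_2$ means $(p_2-p_1)^->0$. $\mathcal{P}_b^{\log}(X)$ is the set of $p\in\mathcal{P}_b(X)$ such that $1/p$ is locally log-Hölder continuous: there is $C\in(0,\infty)$ with $|1/p(x)-1/p(y)|\le C/\log(e+1/d(x,y))$ for all $x,y\in X$. $\mu$ is lower Ahlfors $Q(\cdot)$-regular if there is $b_1\in(0,\infty)$ such that $\mu(B(x,r))\ge b_1r^{Q(x)}$ for all $x\in X$, $r\in(0,1]$. Lebesgue spaces: for $p\in\mathcal{P}_b(X)$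 let $\rho_{p(\cdot)}(u)=\int_X|u(x)|^{p(x)}\,d\mu(x)$. $L^{p(\cdot)}(X,\mu)$ is the space of measurable $u$ with $\rho_{p(\cdot)}(\lambda u)<\infty$ for some $\lambda>0$, with quasi-norm $\|u\|_{L^{p(\cdot)}}=\inf\{\lambda>0:\rho_{p(\cdot)}(u/\lambda)\le1\}$. Hajłasz–Sobolev space: let $s\in\mathcal{P}_b(X)$ and $u:X\to\overline{\mathbb{R}}$ be measurable and finite a.e. A non-negative measurable function $g$ is a scalar $s(\cdot)$-gradient of $u$ (written $g\in\mathcal{D}^{s(\cdot)}(u)$) if there is a $\mu$-null set $N_u$ such that $|u(x)-u(y)|\le d(x,y)^{s(x)}g(x)+d(x,y)^{s(y)}g(y)$ for all $x,y\in X\setminus N_u$. $M^{s(\cdot),p(\cdot)}(X,d,\mu)$ is the space of $u\in L^{p(\cdot)}(X,\mu)$ with $\|u\|_{\dot M^{s(\cdot),p(\cdot)}}:=\inf_{g\in\mathcal{D}^{s(\cdot)}(u)}\|g\|_{L^{p(\cdot)}}<\infty$, with quasi-norm $\|u\|_{L^{p(\cdot)}}+\|u\|_{\dot M^{s(\cdot),p(\cdot)}}$. $Y\hookrightarrow\hookrightarrow Z$ (compact embedding) means $Y\subseteq Z$ with continuous inclusion mapping bounded subsets of $Y$ to totally bounded subsets of $Z$. *)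

theory Defs
  imports "HOL-Probability.Essential_Supremum"
begin

(* X is the whole carrier of a metric-space type; exponents and functions on X take values in
   ereal, so that exponents X -> (0,\<infinity>] and functions X -> [-\<infinity>,\<infinity>] are literal. *)

definition metric_measure_space :: "'a::metric_space measure \<Rightarrow> bool" where
  "metric_measure_space M \<longleftrightarrow>
     sets M = sets borel \<and>
     (\<forall>x. \<forall>r>0. 0 < emeasure M (ball x r) \<and> emeasure M (ball x r) < \<infinity>)"

definition essinf :: "'a measure \<Rightarrow> ('a \<Rightarrow> ereal) \<Rightarrow> ereal" where
  "essinf M f = - esssup M (\<lambda>x. - f x)"

(* t^p for t in [0,\<infinity>] and p in (0,\<infinity>]; the value at p = \<infinity> is the limit as p tends to \<infinity>.
   An essentially bounded exponent takes the value \<infinity> only on a null set. *)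
definition epowr :: "ereal \<Rightarrow> ereal \<Rightarrow> ereal" where
  "epowr t p =
     (if p = \<infinity> then (if t < 1 then 0 else if t = 1 then 1 else \<infinity>)
      else if t = \<infinity> then \<infinity>
      else ereal (real_of_ereal t powr real_of_ereal p))"

definition exponents :: "'a::metric_space measure \<Rightarrow> ('a \<Rightarrow> ereal) set" where
  "exponents M = {p \<in> borel_measurable M. (\<forall>x. 0 < p x) \<and> 0 < essinf M p}"

definition bounded_exponents :: "'a::metric_space measure \<Rightarrow> ('a \<Rightarrow> ereal) set" where
  "bounded_exponents M = {p \<in> exponents M. esssup M p < \<infinity>}"

(* For x = y the left-hand side is 0, so the convention 1 / dist x x = 0 plays no role. *)
definition log_Holder_exponents :: "'a::metric_space measure \<Rightarrow> ('a \<Rightarrow> ereal) set" where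
  "log_Holder_exponents M =
     {p \<in> bounded_exponents M.
        \<exists>C>0. \<forall>x y. \<bar>1 / p x - 1 / p y\<bar> \<le> ereal (C / ln (exp 1 + 1 / dist x y))}"

definition ess_less :: "'a measure \<Rightarrow> ('a \<Rightarrow> ereal) \<Rightarrow> ('a \<Rightarrow> ereal) \<Rightarrow> bool" where
  "ess_less M p\<^sub>1 p\<^sub>2 \<longleftrightarrow> 0 < essinf M (\<lambda>x. p\<^sub>2 x - p\<^sub>1 x)"

definition lower_Ahlfors_regular :: "'a::metric_space measure \<Rightarrow> ('a \<Rightarrow> ereal) \<Rightarrow> bool" where
  "lower_Ahlfors_regular M Q \<longleftrightarrow>
     (\<exists>b>0. \<forall>x. \<forall>r\<in>{0<..1}.
        ereal b * epowr (ereal r) (Q x) \<le> enn2ereal (emeasure M (ball x r)))"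

definition modular :: "'a measure \<Rightarrow> ('a \<Rightarrow> ereal) \<Rightarrow> ('a \<Rightarrow> ereal) \<Rightarrow> ennreal" where
  "modular M p u = (\<integral>\<^sup>+x. e2ennreal (epowr \<bar>u x\<bar> (p x)) \<partial>M)"

definition Lebesgue_space :: "'a measure \<Rightarrow> ('a \<Rightarrow> ereal) \<Rightarrow> ('a \<Rightarrow> ereal) set" where
  "Lebesgue_space M p =
     {u \<in> borel_measurable M. \<exists>l>0. modular M p (\<lambda>x. ereal l * u x) < \<infinity>}"

(* The infimum is taken in [0,\<infinity>], so it is \<infinity> when no l is admissible. *)
definition Lebesgue_norm :: "'a measure \<Rightarrow> ('a \<Rightarrow> ereal) \<Rightarrow> ('a \<Rightarrow> ereal) \<Rightarrow> ennreal" where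
  "Lebesgue_norm M p u =
     (INF l\<in>{l::real. 0 < l \<and> modular M p (\<lambda>x. u x / ereal l) \<le> 1}. ennreal l)"

definition scalar_gradients ::
  "'a::metric_space measure \<Rightarrow> ('a \<Rightarrow> ereal) \<Rightarrow> ('a \<Rightarrow> ereal) \<Rightarrow> ('a \<Rightarrow> ereal) set" where
  "scalar_gradients M s u =
     {g \<in> borel_measurable M. (\<forall>x. 0 \<le> g x) \<and>
        (\<exists>N\<in>null_sets M. \<forall>x\<in>-N. \<forall>y\<in>-N.
           \<bar>u x - u y\<bar> \<le> epowr (ereal (dist x y)) (s x) * g x + epowr (ereal (dist x y)) (s y) * g y)}"

definition Sobolev_seminorm ::
  "'a::metric_space measure \<Rightarrow> ('a \<Rightarrow> ereal) \<Rightarrow> ('a \<Rightarrow> ereal) \<Rightarrow> ('a \<Rightarrow> ereal) \<Rightarrow> ennreal" where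
  "Sobolev_seminorm M s p u = (INF g\<in>scalar_gradients M s u. Lebesgue_norm M p g)"

definition Sobolev_space ::
  "'a::metric_space measure \<Rightarrow> ('a \<Rightarrow> ereal) \<Rightarrow> ('a \<Rightarrow> ereal) \<Rightarrow> ('a \<Rightarrow> ereal) set" where
  "Sobolev_space M s p =
     {u \<in> Lebesgue_space M p. (AE x in M. \<bar>u x\<bar> \<noteq> \<infinity>) \<and> Sobolev_seminorm M s p u < \<infinity>}"

definition Sobolev_norm ::
  "'a::metric_space measure \<Rightarrow> ('a \<Rightarrow> ereal) \<Rightarrow> ('a \<Rightarrow> ereal) \<Rightarrow> ('a \<Rightarrow> ereal) \<Rightarrow> ennreal" where
  "Sobolev_norm M s p u = Lebesgue_norm M p u + Sobolev_seminorm M s p u"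

(* Functions are not identified almost everywhere: (Y, nY) and (Z, nZ) are spaces of functions with
   functionals that vanish on functions equal to 0 a.e. The values of u - v where both are infinite
   are immaterial, since the functions concerned are finite a.e. As in the library notion
   Metric_space.mtotally_bounded, the centres of the balls are taken in A. *)
definition compactly_embedded ::
  "('a \<Rightarrow> ereal) set \<Rightarrow> (('a \<Rightarrow> ereal) \<Rightarrow> ennreal) \<Rightarrow>
   ('a \<Rightarrow> ereal) set \<Rightarrow> (('a \<Rightarrow> ereal) \<Rightarrow> ennreal) \<Rightarrow> bool" where
  "compactly_embedded Y nY Z nZ \<longleftrightarrow>
     Y \<subseteq> Z \<and>
     (\<forall>u\<in>Y. \<forall>\<epsilon>>0. \<exists>\<delta>>0. \<forall>v\<in>Y. nY (\<lambda>x. v x - u x) < \<delta> \<longrightarrow> nZ (\<lambda>x. v x - u x) < \<epsilon>) \<and>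
     (\<forall>A\<subseteq>Y. (\<exists>B<\<infinity>. \<forall>u\<in>A. nY u \<le> B) \<longrightarrow>
        (\<forall>\<epsilon>>0. \<exists>F. finite F \<and> F \<subseteq> A \<and> (\<forall>u\<in>A. \<exists>v\<in>F. nZ (\<lambda>x. u x - v x) < \<epsilon>)))"

end

theory Submission
  imports Defs
begin

text \<open>The embedding rests on one pointwise estimate. Suppose that \<open>u\<close> and its gradient \<open>g\<close> have
modular at most 1 in \<open>L\<^sup>p\<close>. Inside a ball where \<open>p \<ge> P\<close>, Chebyshev's inequality bounds the measure
of \<open>{g > t}\<close> by \<open>t powr - P\<close>, whereas lower regularity bounds the measure of a ball of radius \<open>r\<close>
from below by \<open>b * r powr Q\<close>. Hence every point \<open>x\<close> with \<open>g x \<le> 2 * t\<close> has, within a distance of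
order \<open>t powr - (P / Q)\<close>, a point \<open>y\<close> with \<open>g y \<le> t\<close> (\<open>descent_step\<close>), and then the gradient
inequality bounds \<open>\<bar>u x - u y\<bar>\<close> by a constant times \<open>t powr (1 - s * P / Q)\<close>. In a descent through
dyadic levels to a fixed level, on which \<open>u\<close> is bounded (\<open>bounded_on_level_set\<close>), the distances
and the increments form geometric series. So \<open>\<bar>u\<bar>\<close> is at most a constant times a power of
\<open>max T g\<close> whose exponent is close to \<open>1 - s * p / Q\<close>.

Since \<open>1 - s * p / Q = p / \<gamma>\<close> and \<open>q\<close> stays below \<open>\<gamma>\<close> by a margin, \<open>\<bar>u\<bar> powr q\<close> is bounded by a
constant times \<open>max T g powr (p - h)\<close> for some \<open>h > 0\<close> (\<open>pointwise_bound\<close>). The margin absorbs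
the oscillation of the exponents over small balls: log-Holder exponents are uniformly continuous.
The estimate gives the continuous embedding at once (\<open>modular_bound\<close>).

It also gives compactness (\<open>totally_bounded_modular\<close>). Because of the gain \<open>h\<close>, the part of the
modular of \<open>u - v\<close> over the set where one of the two gradients exceeds \<open>L\<close> becomes small, uniformly
in \<open>u\<close> and \<open>v\<close>, as \<open>L\<close> grows. On \<open>{g \<le> L}\<close> all functions of the family are bounded and Holder
continuous with common constants; as in the Arzela--Ascoli theorem, their rounded values on
a fine finite cover of the space determine them up to a small error, and only finitely many
such codes occur.

The argument is carried out for real exponents on a set of full measure. The last part
translates the extended-real exponents, norms and spaces into this setting.\<close>

section \<open>Preliminaries\<close>

lemma totally_bounded_UNIV_diameter:
  assumes "totally_bounded (UNIV :: 'a::metric_space set)"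
  shows "\<exists>R\<ge>1. \<forall>x y :: 'a. dist x y \<le> R"
proof -
  obtain K :: "'a set" where K: "finite K" "UNIV \<subseteq> (\<Union>c\<in>K. {y. dist c y < 1})"
    using assms unfolding totally_bounded_metric by (meson zero_less_one)
  have "bounded (\<Union>c\<in>K. {y. dist c y < 1})"
    using K(1) by (intro bounded_UN ballI) (auto simp: bounded_def intro!: less_imp_le)
  then have "bounded (UNIV :: 'a set)"
    using K(2) by (rule bounded_subset)
  then obtain R where "\<And>x y :: 'a. dist x y \<le> R"
    unfolding bounded_two_points by auto
  then show ?thesis
    by (intro exI[of _ "max 1 R"]) (auto simp: le_max_iff_disj)
qed

lemma powr_neg_mult_tendsto_0: "((\<lambda>k. c * 2 powr (- real k * a)) \<longlonglongrightarrow> 0)" if "a > 0" for a c :: real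
proof -
  have "(\<lambda>k. c * (2 powr - a) ^ k) \<longlonglongrightarrow> c * 0"
    using that by (intro tendsto_intros LIMSEQ_power_zero) (simp add: powr_less_one)
  also have "(\<lambda>k. c * (2 powr - a) ^ k) = (\<lambda>k. c * 2 powr (- real k * a))"
    by (simp add: powr_realpow[symmetric] powr_powr mult.commute)
  finally show ?thesis by simp
qed

lemma dyadic_above:
  "\<exists>k\<ge>k0. (t::real) \<le> 2 powr real k \<and> 2 powr real k \<le> 2 * max (2 powr real k0) t"
proof -
  define P where "P k \<longleftrightarrow> k \<ge> k0 \<and> t \<le> 2 ^ k" for k :: nat
  define k where "k = (LEAST k. P k)"
  obtain n where "t < 2 ^ n" using real_arch_pow[of 2 t] by auto
  also have "(2::real) ^ n \<le> 2 ^ (max n k0)" by (intro power_increasing) auto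
  finally have "P (max n k0)" by (simp add: P_def)
  then have "P k" unfolding k_def by (rule LeastI)
  then have k: "k \<ge> k0" "t \<le> 2 ^ k" by (simp_all add: P_def)
  have "(2::real) ^ k \<le> 2 * max (2 ^ k0) t"
  proof (cases "k = k0")
    case True
    have "(2::real) ^ k0 \<le> max (2 ^ k0) t" "(0::real) < 2 ^ k0" by simp_all
    then show ?thesis unfolding True by linarith
  next
    case False
    then have pred: "k - 1 \<ge> k0" "k = Suc (k - 1)" using k by auto
    then have "\<not> P (k - 1)" unfolding k_def by (metis lessI not_less_Least)
    with pred have "2 ^ (k - 1) < t" by (simp add: P_def)
    moreover have "(2::real) ^ k = 2 * 2 ^ (k - 1)"
      by (subst pred(2)) simp
    ultimately show ?thesis by simp
  qed
  with k show ?thesis by (intro exI[of _ k]) (auto simp: powr_realpow)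
qed

lemma powr_diff_le:
  fixes y z t r :: real
  assumes "0 < t" "t \<le> 1" "0 \<le> r" "r \<le> e"
  shows "(\<bar>y - z\<bar> / t) powr r \<le> (2 / t) powr e * (\<bar>y\<bar> powr r + \<bar>z\<bar> powr r)"
proof -
  have "(\<bar>y - z\<bar> / t) powr r \<le> (2 / t * max \<bar>y\<bar> \<bar>z\<bar>) powr r"
    using assms by (intro powr_mono2) (auto simp: divide_right_mono)
  also have "\<dots> = (2 / t) powr r * max \<bar>y\<bar> \<bar>z\<bar> powr r"
    using assms by (subst powr_mult) auto
  also have "\<dots> \<le> (2 / t) powr e * (\<bar>y\<bar> powr r + \<bar>z\<bar> powr r)"
    using assms by (intro mult_mono powr_mono) (auto simp: max_def)
  finally show ?thesis .
qed

text \<open>The identity \<open>\<bar>P x - P y\<bar> = P x * P y * \<bar>1 / P x - 1 / P y\<bar>\<close> transfers the modulus of continuity of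
\<open>1 / P\<close> to the bounded function \<open>P\<close>.\<close>
lemma log_Holder_uniformly_continuous:
  fixes P :: "'a::metric_space \<Rightarrow> real"
  assumes P: "\<And>x. x \<in> G \<Longrightarrow> 0 < P x \<and> P x \<le> hi"
    and C: "\<And>x y. x \<in> G \<Longrightarrow> y \<in> G \<Longrightarrow> \<bar>1 / P x - 1 / P y\<bar> \<le> C / ln (exp 1 + 1 / dist x y)"
    and e: "e > 0" and C0: "C > 0"
  shows "\<exists>r>0. \<forall>x\<in>G. \<forall>y\<in>G. dist x y < r \<longrightarrow> \<bar>P x - P y\<bar> < e"
proof (intro exI conjI ballI impI)
  show "0 < exp (- (hi * hi * C / e))" by simp
  fix x y assume xy: "x \<in> G" "y \<in> G" "dist x y < exp (- (hi * hi * C / e))"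
  show "\<bar>P x - P y\<bar> < e"
  proof (cases "x = y")
    case False
    define d where "d = dist x y"
    have d: "d > 0" "d < exp (- (hi * hi * C / e))" using False xy by (auto simp: d_def)
    have hi: "hi > 0" using P[OF xy(1)] by linarith
    have "exp (hi * hi * C / e) < 1 / d"
      using d by (simp add: exp_minus field_simps)
    also have "\<dots> < exp 1 + 1 / d" by simp
    finally have less: "hi * hi * C / e < ln (exp 1 + 1 / d)"
      using d by (subst exp_less_cancel_iff[symmetric], subst exp_ln) (auto intro: add_pos_pos)
    have "0 < hi * hi * C / e" using hi C0 e by simp
    then have ln: "0 < ln (exp 1 + 1 / d)" using less by (rule order_less_trans)
    have ln': "hi * hi * C < e * ln (exp 1 + 1 / d)"
      using e less by (simp add: field_simps)
    have "\<bar>P x - P y\<bar> = P x * P y * \<bar>1 / P x - 1 / P y\<bar>"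
    proof -
      have "P y - P x = P x * P y * (1 / P x - 1 / P y)"
        using P[OF xy(1)] P[OF xy(2)] by (simp add: field_simps)
      then have "\<bar>P y - P x\<bar> = \<bar>P x * P y\<bar> * \<bar>1 / P x - 1 / P y\<bar>" by (simp only: abs_mult)
      then show ?thesis using P[OF xy(1)] P[OF xy(2)] by (simp add: abs_minus_commute)
    qed
    also have "\<dots> \<le> (hi * hi) * (C / ln (exp 1 + 1 / d))"
      using P[OF xy(1)] P[OF xy(2)] C[OF xy(1,2)] hi unfolding d_def
      by (intro mult_mono) auto
    also have "\<dots> < e" using ln ln' by (simp add: field_simps)
    finally show ?thesis .
  qed (use e in simp)
qed

section \<open>Subcritical exponents on a set of full measure\<close>

text \<open>All exponents are real-valued and satisfy their hypotheses at every point of the set \<open>G\<close> of full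
measure, with common bounds \<open>lo\<close> and \<open>hi\<close>. The assumptions \<open>subcritical\<close> and \<open>gap\<close> say that
\<open>s * p\<close> stays below \<open>Q\<close>, and \<open>q\<close> below \<open>Q * p / (Q - s * p)\<close>, by a margin; clearing the denominator
of the latter keeps all estimates polynomial.\<close>
locale subcritical_exponents =
  fixes M :: "'a::metric_space measure"
    and p s Q q :: "'a \<Rightarrow> real"
    and G :: "'a set"
    and lo hi b \<delta> :: real
  assumes sets_M [measurable_cong, simp]: "sets M = sets borel"
    and ball_pos: "r > 0 \<Longrightarrow> 0 < emeasure M (ball x r)"
    and totally_bounded: "totally_bounded (UNIV :: 'a set)"
    and finite_measure: "emeasure M UNIV < \<infinity>"
    and p_measurable [measurable]: "p \<in> borel_measurable M"
    and AE_G: "AE x in M. x \<in> G"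
    and lo: "0 < lo" "lo \<le> 1" and hi: "1 \<le> hi"
    and bounds: "x \<in> G \<Longrightarrow> p x \<in> {lo..hi} \<and> s x \<in> {lo..hi} \<and> Q x \<in> {lo..hi} \<and> q x \<in> {lo..hi}"
    and uniformly_continuous:
      "e > 0 \<Longrightarrow> \<exists>r>0. \<forall>x\<in>G. \<forall>y\<in>G. dist x y < r \<longrightarrow>
         \<bar>p x - p y\<bar> < e \<and> \<bar>s x - s y\<bar> < e \<and> \<bar>Q x - Q y\<bar> < e"
    and b: "0 < b" "b \<le> 1"
    and lower_regular:
      "x \<in> G \<Longrightarrow> 0 < r \<Longrightarrow> r \<le> 1 \<Longrightarrow> ennreal (b * r powr Q x) \<le> emeasure M (ball x r)"
    and \<delta>: "0 < \<delta>"
    and subcritical: "x \<in> G \<Longrightarrow> s x * p x + \<delta> \<le> Q x"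
    and gap: "x \<in> G \<Longrightarrow> q x * (Q x - s x * p x) + \<delta> \<le> Q x * p x"
begin

lemma space_M [simp]: "space M = UNIV"
  using sets_eq_imp_space_eq[OF sets_M] by simp

text \<open>Normalised pairs: the unit balls of \<open>L\<^sup>p\<close>, for a function and for one of its
gradients, both real-valued. The null set absorbs the points where an extended-real function is
infinite or the exponents are not controlled.\<close>
definition admissible :: "('a \<Rightarrow> real) \<Rightarrow> ('a \<Rightarrow> real) \<Rightarrow> bool" where
  "admissible u g \<longleftrightarrow>
     u \<in> borel_measurable M \<and> g \<in> borel_measurable M \<and> (\<forall>x. 0 \<le> g x) \<and>
     (\<integral>\<^sup>+x. ennreal (\<bar>u x\<bar> powr p x) \<partial>M) \<le> 1 \<and>
     (\<integral>\<^sup>+x. ennreal (g x powr p x) \<partial>M) \<le> 1 \<and>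
     (\<exists>N\<in>null_sets M. \<forall>x\<in>-N. \<forall>y\<in>-N.
        \<bar>u x - u y\<bar> \<le> dist x y powr s x * g x + dist x y powr s y * g y)"

lemma measure_positive: "0 < measure M UNIV"
  and emeasure_eq_measure: "emeasure M UNIV = ennreal (measure M UNIV)"
proof -
  show eq: "emeasure M UNIV = ennreal (measure M UNIV)"
    using finite_measure by (intro emeasure_eq_ennreal_measure) auto
  have "0 < emeasure M (ball undefined 1)" by (rule ball_pos) simp
  also have "\<dots> \<le> emeasure M UNIV" by (intro emeasure_mono) auto
  finally show "0 < measure M UNIV" unfolding eq by simp
qed

lemma chebyshev:
  assumes [measurable]: "f \<in> borel_measurable M" "D \<in> sets M"
    and f: "(\<integral>\<^sup>+x. ennreal (f x powr p x) \<partial>M) \<le> 1"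
    and t: "t \<ge> 1" and P: "\<And>x. x \<in> D \<inter> G \<Longrightarrow> P \<le> p x"
  shows "emeasure M {x \<in> D. t < f x} \<le> ennreal (t powr - P)"
proof -
  have *: "AE x in M. indicator {x \<in> D. t < f x} x \<le> ennreal (t powr - P) * ennreal (f x powr p x)"
    using AE_G
  proof eventually_elim
    case (elim x)
    show ?case
    proof (cases "x \<in> D \<and> t < f x")
      case True
      have "1 = t powr - P * t powr P"
        using t by (simp add: powr_minus)
      also have "\<dots> \<le> t powr - P * t powr p x"
        using True elim P[of x] t by (intro mult_left_mono powr_mono) auto
      also have "\<dots> \<le> t powr - P * f x powr p x"
        using True t elim bounds[of x] lo by (intro mult_left_mono powr_mono2) auto
      finally show ?thesis
        using True by (simp add: ennreal_mult[symmetric])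
    qed auto
  qed
  have "{x \<in> D. t < f x} = {x \<in> space M. x \<in> D \<and> t < f x}" by auto
  then have [measurable]: "{x \<in> D. t < f x} \<in> sets M" by simp
  have "emeasure M {x \<in> D. t < f x} = (\<integral>\<^sup>+x. indicator {x \<in> D. t < f x} x \<partial>M)"
    by simp
  also have "\<dots> \<le> (\<integral>\<^sup>+x. ennreal (t powr - P) * ennreal (f x powr p x) \<partial>M)"
    by (rule nn_integral_mono_AE[OF *])
  also have "\<dots> = ennreal (t powr - P) * (\<integral>\<^sup>+x. ennreal (f x powr p x) \<partial>M)"
    by (intro nn_integral_cmult) measurable
  also have "\<dots> \<le> ennreal (t powr - P) * 1"
    by (intro mult_left_mono f) auto
  finally show ?thesis by simp
qed

text \<open>If \<open>g\<close> exceeded \<open>t\<close> almost everywhere in the ball, Chebyshev's inequality would make the ball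
smaller than lower regularity allows. The set \<open>H\<close> of full measure lets the new point avoid the
exceptional points of the gradient inequality.\<close>
lemma descent_step:
  assumes [measurable]: "g \<in> borel_measurable M"
    and g: "(\<integral>\<^sup>+x. ennreal (g x powr p x) \<partial>M) \<le> 1"
    and H: "AE x in M. x \<in> H"
    and x: "x \<in> G" and r: "0 < r" "r \<le> 1" and t: "t \<ge> 1"
    and P: "\<And>y. y \<in> ball x r \<inter> G \<Longrightarrow> P \<le> p y" and K: "Q x \<le> K"
    and less: "t powr - P < b * r powr K"
  shows "\<exists>y\<in>H. dist x y < r \<and> g y \<le> t"
proof (rule ccontr)
  assume none: "\<not> ?thesis"
  have [measurable]: "ball x r \<in> sets M" by simp
  have "{y \<in> ball x r. t < g y} = ball x r \<inter> {y \<in> space M. t < g y}" by auto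
  also have "\<dots> \<in> sets M" by measurable
  finally have meas: "{y \<in> ball x r. t < g y} \<in> sets M" .
  have "AE y in M. y \<in> ball x r \<longrightarrow> y \<in> {y \<in> ball x r. t < g y}"
    using H by eventually_elim (use none not_le in auto)
  then have "emeasure M (ball x r) \<le> emeasure M {y \<in> ball x r. t < g y}"
    using meas by (rule emeasure_mono_AE)
  also have "\<dots> \<le> ennreal (t powr - P)"
    using P by (intro chebyshev g t) auto
  also have "\<dots> < ennreal (b * r powr K)"
    using less by (simp add: ennreal_less_iff)
  also have "\<dots> \<le> ennreal (b * r powr Q x)"
    using r K b by (intro ennreal_leI mult_left_mono powr_mono') auto
  also have "\<dots> \<le> emeasure M (ball x r)"
    using x r by (rule lower_regular)
  finally show False by simp
qed

text \<open>The exponent \<open>\<beta>\<close> arises in the descent when \<open>s\<close>, \<open>p\<close>, \<open>Q\<close> are replaced by their worst values in a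
small ball, where they have oscillation at most \<open>e\<close>. As \<open>e\<close> tends to 0, \<open>\<beta>\<close> tends to
\<open>1 - s * p / Q\<close> uniformly; \<open>gap\<close> then bounds \<open>q * \<beta>\<close> away from \<open>p\<close>, and \<open>subcritical\<close> bounds \<open>\<beta>\<close>
away from 0.\<close>
lemma exponent_margin:
  "\<exists>e h. 0 < e \<and> e \<le> lo / 2 \<and> 0 < h \<and> h \<le> lo \<and>
    (\<forall>x\<in>G. let \<beta> = 1 - (s x - e) * (p x - e) / (Q x + e)
           in \<delta> / (hi + 1) \<le> \<beta> \<and> \<beta> \<le> 1 \<and> q x * \<beta> \<le> p x - h)"
proof -
  define e where "e = min (lo / 2) (\<delta> / (2 * hi * (1 + 2 * hi)))"
  define h where "h = min lo (\<delta> / (2 * (hi + 1)))"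
  have e: "0 < e" "e \<le> lo / 2" "e \<le> \<delta> / (2 * hi * (1 + 2 * hi))"
    unfolding e_def using lo(1) hi \<delta> by (simp_all only: min.cobounded1 min.cobounded2) simp
  have e1: "e * hi * (1 + 2 * hi) \<le> \<delta> / 2"
  proof -
    have "e * (2 * hi * (1 + 2 * hi)) \<le> \<delta>"
      using e(3) hi by (subst (asm) pos_le_divide_eq) (auto intro!: mult_pos_pos)
    then show ?thesis by (simp add: algebra_simps)
  qed
  have h: "0 < h" "h \<le> lo"
    unfolding h_def using lo hi \<delta> by simp_all
  have "h * (hi + 1) \<le> \<delta> / (2 * (hi + 1)) * (hi + 1)"
    unfolding h_def using hi by (intro mult_right_mono min.cobounded2) auto
  also have "\<dots> = \<delta> / 2" using hi by (simp add: field_simps)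
  finally have h1: "h * (hi + 1) \<le> \<delta> / 2" .
  have main: "\<delta> / (hi + 1) \<le> B \<and> B \<le> 1 \<and> q x * B \<le> p x - h"
    if x: "x \<in> G" and B: "B = 1 - (s x - e) * (p x - e) / (Q x + e)" for x B
  proof -
    have bd: "lo \<le> p x" "p x \<le> hi" "lo \<le> s x" "s x \<le> hi" "lo \<le> Q x" "Q x \<le> hi" "lo \<le> q x" "q x \<le> hi"
      using bounds[OF x] by auto
    have pos: "0 < Q x + e" using bd lo e by linarith
    have prod: "0 \<le> (s x - e) * (p x - e)"
      using bd e lo by (intro mult_nonneg_nonneg) linarith+
    have BQ: "B * (Q x + e) = Q x - s x * p x + e * (1 + s x + p x - e)"
      unfolding B using pos by (simp add: field_simps)
    have pe: "0 \<le> 1 + s x + p x - e" using bd lo e by linarith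
    have "\<delta> \<le> B * (Q x + e)"
      unfolding BQ using subcritical[OF x] mult_nonneg_nonneg[of e, OF _ pe] e by linarith
    then have "\<delta> / (Q x + e) \<le> B" using pos by (simp add: field_simps)
    moreover have "\<delta> / (hi + 1) \<le> \<delta> / (Q x + e)"
      using \<delta> pos bd e lo by (intro divide_left_mono) auto
    moreover have "B \<le> 1" unfolding B using prod pos by simp
    moreover have "q x * B * (Q x + e) \<le> (p x - h) * (Q x + e)"
    proof -
      have "q x * B * (Q x + e) = q x * (Q x - s x * p x) + q x * (e * (1 + s x + p x - e))"
        unfolding mult.assoc BQ by (simp only: distrib_left)
      also have "q x * (e * (1 + s x + p x - e)) \<le> hi * (e * (1 + 2 * hi))"
      proof (rule mult_mono)
        show "e * (1 + s x + p x - e) \<le> e * (1 + 2 * hi)"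
          using bd e by (intro mult_left_mono) linarith+
        show "0 \<le> e * (1 + s x + p x - e)" using pe e by simp
      qed (use bd hi in linarith)+
      also have "\<dots> \<le> \<delta> / 2" using e1 by (simp add: algebra_simps)
      also have "q x * (Q x - s x * p x) + \<delta> / 2 \<le> Q x * p x - h * (hi + 1)"
        using gap[OF x] h1 by simp
      also have "\<dots> \<le> Q x * p x - h * (Q x + e) + p x * e"
      proof -
        have "h * (Q x + e) \<le> h * (hi + 1)"
          using h bd e lo by (intro mult_left_mono) auto
        moreover have "0 \<le> p x * e" using bd lo e by auto
        ultimately show ?thesis by linarith
      qed
      finally show ?thesis by (simp add: algebra_simps)
    qed
    then have "q x * B \<le> p x - h" using pos by simp
    ultimately show ?thesis by linarith
  qed
  show ?thesis
    unfolding Let_def using e h main[OF _ refl] by (intro exI[of _ e] exI[of _ h]) simp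
qed


text \<open>For large \<open>T\<close>, Chebyshev's inequality applied to \<open>u\<close> and to \<open>g\<close> leaves a point \<open>z\<close> where both are
at most \<open>T\<close>; the gradient inequality compares every other point of the level set with \<open>z\<close>, since the
space has finite diameter.\<close>
lemma bounded_on_level_set:
  assumes ug: "admissible u g" and T: "1 \<le> T" "2 * T powr - lo < measure M UNIV"
    and R: "1 \<le> R" "\<And>x y :: 'a. dist x y \<le> R"
  shows "AE x in M. g x \<le> T \<longrightarrow> \<bar>u x\<bar> \<le> T + 2 * R powr hi * T"
proof -
  from ug have [measurable]: "u \<in> borel_measurable M" "g \<in> borel_measurable M"
    and gpos: "\<And>x. 0 \<le> g x"
    and u1: "(\<integral>\<^sup>+x. ennreal (\<bar>u x\<bar> powr p x) \<partial>M) \<le> 1"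
    and g1: "(\<integral>\<^sup>+x. ennreal (g x powr p x) \<partial>M) \<le> 1"
    unfolding admissible_def by auto
  from ug obtain N where N: "N \<in> null_sets M"
    and grad: "\<And>x y. x \<in> - N \<Longrightarrow> y \<in> - N \<Longrightarrow>
        \<bar>u x - u y\<bar> \<le> dist x y powr s x * g x + dist x y powr s y * g y"
    unfolding admissible_def by blast
  have good: "AE x in M. x \<in> G - N"
    using AE_G AE_not_in[OF N] by eventually_elim auto
  have "\<exists>z\<in>G - N. \<bar>u z\<bar> \<le> T \<and> g z \<le> T"
  proof (rule ccontr)
    assume none: "\<not> ?thesis"
    let ?U = "{x \<in> UNIV. T < \<bar>u x\<bar>}" and ?V = "{x \<in> UNIV. T < g x}"
    have "{x \<in> space M. T < \<bar>u x\<bar>} \<in> sets M" "{x \<in> space M. T < g x} \<in> sets M"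
      by measurable
    then have UV: "?U \<in> sets M" "?V \<in> sets M" by simp_all
    have "emeasure M UNIV \<le> emeasure M (?U \<union> ?V)"
    proof (rule emeasure_mono_AE)
      show "AE x in M. x \<in> UNIV \<longrightarrow> x \<in> ?U \<union> ?V"
        using good by eventually_elim (use none not_le in auto)
    qed (rule sets.Un[OF UV])
    also have "\<dots> \<le> emeasure M ?U + emeasure M ?V"
      by (rule emeasure_subadditive[OF UV])
    also have "\<dots> \<le> ennreal (T powr - lo) + ennreal (T powr - lo)"
      using bounds by (intro add_mono chebyshev u1 g1 T) auto
    also have "\<dots> = ennreal (2 * T powr - lo)"
      by (simp flip: ennreal_plus)
    also have "\<dots> < ennreal (measure M UNIV)"
      using T by (simp add: ennreal_less_iff)
    also have "\<dots> = emeasure M UNIV"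
      using finite_measure by (intro emeasure_eq_ennreal_measure[symmetric]) auto
    finally show False by simp
  qed
  then obtain z where z: "z \<in> G" "z \<notin> N" "\<bar>u z\<bar> \<le> T" "g z \<le> T" by auto
  have dist_le: "dist x y powr s w \<le> R powr hi" if "w \<in> G" for x y w :: 'a
  proof -
    have "dist x y powr s w \<le> R powr s w"
      using R bounds[OF that] lo by (intro powr_mono2) auto
    also have "\<dots> \<le> R powr hi"
      using R bounds[OF that] by (intro powr_mono) auto
    finally show ?thesis .
  qed
  show ?thesis
    using good
  proof eventually_elim
    case (elim x)
    show ?case
    proof
      assume gx: "g x \<le> T"
      have "\<bar>u x\<bar> \<le> \<bar>u z\<bar> + \<bar>u x - u z\<bar>" by linarith
      also have "\<bar>u x - u z\<bar> \<le> dist x z powr s x * g x + dist x z powr s z * g z"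
        using grad z elim by auto
      also have "\<dots> \<le> R powr hi * T + R powr hi * T"
        using elim z gx gpos by (intro add_mono mult_mono dist_le) auto
      finally show "\<bar>u x\<bar> \<le> T + 2 * R powr hi * T"
        using z by linarith
    qed
  qed
qed

section \<open>The pointwise bound\<close>

text \<open>The descent from a point \<open>x0\<close> stays in a ball around \<open>x0\<close> in which the exponents are controlled
by their values at \<open>x0\<close>; the starting level \<open>k0\<close> is chosen so high that the distances, which sum up
like a geometric series, never leave this ball.\<close>
lemma pointwise_bound:
  "\<exists>C\<ge>1. \<exists>T\<ge>1. \<exists>h>0. h \<le> lo \<and> (\<forall>u g. admissible u g \<longrightarrow>
     (AE x in M. \<bar>u x\<bar> powr q x \<le> C * max T (g x) powr (p x - h)))"
proof -
  obtain R where R: "R \<ge> 1" "\<And>x y :: 'a. dist x y \<le> R"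
    using totally_bounded_UNIV_diameter[OF totally_bounded] by blast
  obtain e h where e: "0 < e" "e \<le> lo / 2" and h: "0 < h" "h \<le> lo"
    and margin: "\<forall>x\<in>G. let \<beta> = 1 - (s x - e) * (p x - e) / (Q x + e)
           in \<delta> / (hi + 1) \<le> \<beta> \<and> \<beta> \<le> 1 \<and> q x * \<beta> \<le> p x - h"
    using exponent_margin by auto
  obtain r0 where r0: "r0 > 0"
    and uc: "\<And>x y. x \<in> G \<Longrightarrow> y \<in> G \<Longrightarrow> dist x y < r0 \<Longrightarrow>
         \<bar>p x - p y\<bar> < e \<and> \<bar>s x - s y\<bar> < e \<and> \<bar>Q x - Q y\<bar> < e"
    using uniformly_continuous[OF e(1)] by blast
  define \<theta> where "\<theta> = (lo / 2) / (hi + 1)"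
  have \<theta>: "\<theta> > 0" unfolding \<theta>_def using lo hi by auto
  \<comment> \<open>\<open>D\<close> is chosen so that \<open>r = D * 2 powr (- k * (P / K))\<close> is a suitable radius for the step
    from level \<open>2 powr k\<close> to \<open>2 powr (k - 1)\<close>: this needs \<open>2 powr P < b * D powr K\<close>.\<close>
  define D where "D = (2 powr (hi + 1) / b) powr (1 / lo)"
  have base: "1 \<le> 2 powr (hi + 1) / b"
    using b hi ge_one_powr_ge_zero[of 2 "hi + 1"] by (simp add: field_simps)
  have D1: "D \<ge> 1"
    unfolding D_def using base lo by (intro ge_one_powr_ge_zero) auto
  have D: "2 powr P < b * D powr K" if "P \<le> hi" "K \<ge> lo" for P K
  proof -
    have "2 powr P < 2 powr (hi + 1)" using that by simp
    also have "\<dots> = b * D powr lo"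
      unfolding D_def powr_powr using base lo b by simp
    also have "\<dots> \<le> b * D powr K"
      using that D1 b by (intro mult_left_mono powr_mono) auto
    finally show ?thesis .
  qed
  \<comment> \<open>\<open>D'\<close> sums the geometric series of the radii \<open>D * 2 powr (- k * \<theta>)\<close>, and \<open>C1\<close> below that of
    the increments; \<open>\<theta>\<close> and \<open>\<beta>0\<close> are lower bounds for \<open>P / K\<close> and \<open>\<beta>\<close>.\<close>
  define D' where "D' = D / (2 powr \<theta> - 1)"
  have two\<theta>: "2 powr \<theta> - 1 > 0" using \<theta> by simp
  have D'0: "D' > 0" using two\<theta> D1 unfolding D'_def by auto
  have D'D: "D' + D = D' * 2 powr \<theta>"
  proof -
    have "D = D' * (2 powr \<theta> - 1)"
      unfolding D'_def by (rule nonzero_divide_eq_eq[THEN iffD1, OF _ refl]) (use two\<theta> in linarith)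
    then show ?thesis by (simp add: algebra_simps)
  qed
  define \<beta>0 where "\<beta>0 = \<delta> / (hi + 1)"
  have \<beta>0: "\<beta>0 > 0" unfolding \<beta>0_def using \<delta> hi by auto
  have less1: "2 powr - \<beta>0 < 1" using \<beta>0 by (simp add: powr_less_one)
  define C1 where "C1 = 2 * D powr hi / (1 - 2 powr - \<beta>0)"
  have C1: "C1 \<ge> 0" unfolding C1_def using less1 by auto
  \<comment> \<open>The three conditions bound the radii by 1, keep the descent inside the ball of radius \<open>r0\<close>, and
    make the level \<open>2 powr k\<close> suitable for \<open>bounded_on_level_set\<close>.\<close>
  have "\<forall>\<^sub>F k in sequentially. D * 2 powr (- real k * \<theta>) < 1 \<and> D' * 2 powr (- real k * \<theta>) < r0 \<and>
      2 * 2 powr (- real k * lo) < measure M UNIV"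
    using \<theta> lo r0 measure_positive
    by (intro eventually_conj order_tendstoD(2)[OF powr_neg_mult_tendsto_0]) auto
  then obtain k0 where k0: "D * 2 powr (- real k0 * \<theta>) < 1" "D' * 2 powr (- real k0 * \<theta>) < r0"
      "2 * 2 powr (- real k0 * lo) < measure M UNIV"
    by (auto simp: eventually_sequentially)
  define T :: real where "T = 2 powr real k0"
  have T: "T \<ge> 1" unfolding T_def by (simp add: ge_one_powr_ge_zero)
  have Tm: "2 * T powr - lo < measure M UNIV"
    using k0(3) unfolding T_def by (simp add: powr_powr)
  define A where "A = T + 2 * R powr hi * T"
  have A: "A \<ge> 1" unfolding A_def using T R by (smt (verit) mult_nonneg_nonneg powr_ge_zero)
  define C where "C = (2 * (A + C1)) powr hi"
  have "C \<ge> 1" unfolding C_def using A C1 hi by (intro ge_one_powr_ge_zero) auto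
  have "AE x in M. \<bar>u x\<bar> powr q x \<le> C * max T (g x) powr (p x - h)" if ug: "admissible u g" for u g
  proof -
    from ug have [measurable]: "u \<in> borel_measurable M" "g \<in> borel_measurable M"
      and gpos: "\<And>x. 0 \<le> g x"
      and g1: "(\<integral>\<^sup>+x. ennreal (g x powr p x) \<partial>M) \<le> 1"
      unfolding admissible_def by auto
    from ug obtain N where N: "N \<in> null_sets M"
      and grad: "\<And>x y. x \<in> - N \<Longrightarrow> y \<in> - N \<Longrightarrow>
          \<bar>u x - u y\<bar> \<le> dist x y powr s x * g x + dist x y powr s y * g y"
      unfolding admissible_def by blast
    define H where "H = {x \<in> G - N. g x \<le> T \<longrightarrow> \<bar>u x\<bar> \<le> A}"
    have H: "AE x in M. x \<in> H"
      using AE_G AE_not_in[OF N] bounded_on_level_set[OF ug T Tm R]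
      by eventually_elim (auto simp: H_def A_def)
    show ?thesis
      using H
    proof eventually_elim
      case (elim x0)
      then have x0: "x0 \<in> G" by (simp add: H_def)
      define P where "P = p x0 - e"
      define S where "S = s x0 - e"
      define K where "K = Q x0 + e"
      define \<beta> where "\<beta> = 1 - S * P / K"
      have \<beta>: "\<beta>0 \<le> \<beta>" "\<beta> \<le> 1" "q x0 * \<beta> \<le> p x0 - h"
        using bspec[OF margin x0]
        unfolding \<beta>_def \<beta>0_def S_def P_def K_def Let_def by blast+
      have PSK: "lo / 2 \<le> P" "P \<le> hi" "lo / 2 \<le> S" "S \<le> hi" "lo \<le> K" "K \<le> hi + 1"
        using bounds[OF x0] e lo unfolding P_def S_def K_def by auto
      have near: "P \<le> p y" "S \<le> s y" "Q y \<le> K" if "y \<in> G" "dist x0 y < r0" for y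
        using uc[OF x0 that] unfolding P_def S_def K_def by auto
      have \<theta>PK: "\<theta> \<le> P / K"
        unfolding \<theta>_def using PSK lo by (intro frac_le) auto
      \<comment> \<open>The allowed distance from \<open>x0\<close> decreases as the level grows: it leaves room for the steps that
        led from \<open>x0\<close> at a higher level to \<open>x\<close>.\<close>
      have claim: "\<bar>u x\<bar> \<le> A + C1 * 2 powr (real (k0 + j) * \<beta>)"
        if "x \<in> H" "dist x0 x \<le> D' * 2 powr (- real (k0 + j) * \<theta>)" "g x \<le> 2 powr real (k0 + j)" for j x
        using that
      proof (induction j arbitrary: x)
        case 0
        then have "\<bar>u x\<bar> \<le> A" by (auto simp: H_def T_def)
        also have "\<dots> \<le> A + C1 * 2 powr (real (k0 + 0) * \<beta>)" using C1 by simp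
        finally show ?case .
      next
        case (Suc j x)
        define k where "k = real (k0 + j)"
        have k: "real (k0 + Suc j) = k + 1" "k \<ge> real k0" by (auto simp: k_def)
        have kmono: "2 powr (- k * \<theta>) \<le> 2 powr (- real k0 * \<theta>)"
          using k \<theta> by simp
        define r where "r = D * 2 powr (- (k + 1) * (P / K))"
        have r_le: "r \<le> D * 2 powr (- (k + 1) * \<theta>)"
        proof -
          have "(k + 1) * \<theta> \<le> (k + 1) * (P / K)"
            using k by (intro mult_left_mono \<theta>PK) auto
          then have "- (k + 1) * (P / K) \<le> - (k + 1) * \<theta>"
            by (simp only: mult_minus_left neg_le_iff_le)
          then have "2 powr (- (k + 1) * (P / K)) \<le> 2 powr (- (k + 1) * \<theta>)"
            by (rule powr_mono) simp
          then show ?thesis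
            unfolding r_def using D1 by (intro mult_left_mono) auto
        qed
        also have "\<dots> \<le> D * 2 powr (- k * \<theta>)"
          using D1 \<theta> by (intro mult_left_mono powr_mono mult_right_mono) auto
        also have "\<dots> \<le> D * 2 powr (- real k0 * \<theta>)"
          using D1 kmono by (intro mult_left_mono) auto
        also have "\<dots> < 1" by (rule k0)
        finally have r: "0 < r" "r \<le> 1"
          using D1 by (simp_all add: r_def)
        have x: "x \<in> H" "g x \<le> 2 powr (k + 1)"
          and x_dist: "dist x0 x \<le> D' * 2 powr (- (k + 1) * \<theta>)"
          using Suc.prems unfolding k(1) by blast+
        have "x \<in> G" using x by (simp add: H_def)
        have reach: "dist x0 y \<le> D' * 2 powr (- k * \<theta>)" "dist x0 y < r0" if "dist x y < r" for y
        proof -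
          have "dist x0 y \<le> dist x0 x + dist x y" by (rule dist_triangle)
          also have "\<dots> \<le> D' * 2 powr (- (k + 1) * \<theta>) + D * 2 powr (- (k + 1) * \<theta>)"
            using that r_le x_dist by (intro add_mono) auto
          also have "\<dots> = (D' + D) * 2 powr (- (k + 1) * \<theta>)" by (simp add: algebra_simps)
          also have "\<dots> = D' * (2 powr \<theta> * 2 powr (- (k + 1) * \<theta>))"
            unfolding D'D by simp
          also have "2 powr \<theta> * 2 powr (- (k + 1) * \<theta>) = 2 powr (- k * \<theta>)"
            by (simp add: powr_add[symmetric] algebra_simps)
          finally show 1: "dist x0 y \<le> D' * 2 powr (- k * \<theta>)" .
          also have "\<dots> \<le> D' * 2 powr (- real k0 * \<theta>)"
            using D'0 kmono by (intro mult_left_mono) auto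
          finally show "dist x0 y < r0" using k0 by simp
        qed
        have x0x: "dist x0 x < r0" using reach[of x] r by simp
        have "\<exists>y\<in>H. dist x y < r \<and> g y \<le> 2 powr k"
        proof (rule descent_step[OF _ g1 H \<open>x \<in> G\<close> r])
          show "1 \<le> 2 powr k" using k by (intro ge_one_powr_ge_zero) auto
          show "P \<le> p y" if "y \<in> ball x r \<inter> G" for y
            using that reach near by auto
          show "Q x \<le> K" using near \<open>x \<in> G\<close> x0x by auto
          have "(2 powr k) powr - P = 2 powr P * 2 powr (- (k + 1) * P)"
            by (simp add: powr_powr powr_add[symmetric] algebra_simps)
          also have "\<dots> < (b * D powr K) * 2 powr (- (k + 1) * P)"
            using D[of P K] PSK by (intro mult_strict_right_mono) auto
          also have "\<dots> = b * r powr K"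
            unfolding r_def using D1 PSK lo by (simp add: powr_mult powr_powr)
          finally show "(2 powr k) powr - P < b * r powr K" .
        qed measurable
        then obtain y where y: "y \<in> H" "dist x y < r" "g y \<le> 2 powr k" by blast
        have uy: "\<bar>u y\<bar> \<le> A + C1 * 2 powr (k * \<beta>)"
          using Suc.IH[of y] y reach[of y] unfolding k_def by auto
        have pw: "dist x y powr s w \<le> r powr S" if "w \<in> G" "dist x0 w < r0" for w
        proof -
          have "dist x y powr s w \<le> r powr s w"
            using y bounds[OF that(1)] lo by (intro powr_mono2) auto
          also have "\<dots> \<le> r powr S"
            using near(2)[OF that] r by (intro powr_mono') auto
          finally show ?thesis .
        qed
        have "\<bar>u x - u y\<bar> \<le> dist x y powr s x * g x + dist x y powr s y * g y"
          using grad x(1) y(1) by (simp add: H_def)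
        also have "\<dots> \<le> r powr S * 2 powr (k + 1) + r powr S * 2 powr (k + 1)"
        proof -
          have "g y \<le> 2 powr (k + 1)" using y(3) by (rule order_trans) simp
          moreover have "y \<in> G" using y by (simp add: H_def)
          ultimately show ?thesis
            using \<open>x \<in> G\<close> x(2) y(2) gpos x0x reach[of y] by (intro add_mono mult_mono pw) auto
        qed
        also have "\<dots> = 2 * (r powr S * 2 powr (k + 1))" by simp
        also have "r powr S * 2 powr (k + 1) = D powr S * 2 powr ((k + 1) * \<beta>)"
        proof -
          have "- (k + 1) * (P / K) * S + (k + 1) = (k + 1) * \<beta>"
            unfolding \<beta>_def by (simp add: algebra_simps add_divide_distrib)
          then show ?thesis
            unfolding r_def using D1 by (simp add: powr_mult powr_powr powr_add[symmetric] mult.assoc)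
        qed
        also have "\<dots> \<le> D powr hi * 2 powr ((k + 1) * \<beta>)"
          using D1 PSK by (intro mult_right_mono powr_mono) auto
        finally have step: "\<bar>u x - u y\<bar> \<le> 2 * D powr hi * 2 powr ((k + 1) * \<beta>)" by simp
        \<comment> \<open>The bound at level \<open>k\<close> plus the increment is at most that at level \<open>k + 1\<close>, by the choice of \<open>C1\<close>.\<close>
        have "2 powr - \<beta> \<le> 2 powr - \<beta>0" using \<beta> by simp
        then have "C1 * 2 powr - \<beta> \<le> C1 * 2 powr - \<beta>0" using C1 by (rule mult_left_mono)
        moreover have "C1 * (1 - 2 powr - \<beta>0) = 2 * D powr hi"
          unfolding C1_def using \<beta>0 by simp
        ultimately have "C1 * 2 powr - \<beta> + 2 * D powr hi \<le> C1" by (simp add: algebra_simps)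
        then have "(C1 * 2 powr - \<beta> + 2 * D powr hi) * 2 powr ((k + 1) * \<beta>) \<le> C1 * 2 powr ((k + 1) * \<beta>)"
          by (rule mult_right_mono) simp
        moreover have "2 powr - \<beta> * 2 powr ((k + 1) * \<beta>) = 2 powr (k * \<beta>)"
          by (simp add: powr_add[symmetric] algebra_simps)
        ultimately have "C1 * 2 powr (k * \<beta>) + 2 * D powr hi * 2 powr ((k + 1) * \<beta>) \<le> C1 * 2 powr ((k + 1) * \<beta>)"
          by (simp add: algebra_simps)
        moreover have "\<bar>u x\<bar> \<le> \<bar>u y\<bar> + \<bar>u x - u y\<bar>" by linarith
        ultimately show ?case using uy step unfolding k(1) by linarith
      qed
      obtain k where k: "k \<ge> k0" "g x0 \<le> 2 powr real k" "2 powr real k \<le> 2 * max T (g x0)"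
        unfolding T_def using dyadic_above by blast
      let ?H = "max T (g x0)"
      have H1: "?H \<ge> 1" using T by simp
      have "2 powr (real k * \<beta>) \<le> (2 * ?H) powr \<beta>"
        using k \<beta> \<beta>0 powr_mono2[of \<beta> "2 powr real k" "2 * ?H"] by (simp add: powr_powr)
      also have "\<dots> = 2 powr \<beta> * ?H powr \<beta>"
        using H1 by (simp add: powr_mult)
      also have "\<dots> \<le> 2 * ?H powr \<beta>"
        using powr_mono[of \<beta> 1 2] \<beta> by (intro mult_right_mono) auto
      finally have dyadic: "2 powr (real k * \<beta>) \<le> 2 * ?H powr \<beta>" .
      have "\<bar>u x0\<bar> \<le> A + C1 * 2 powr (real k * \<beta>)"
        using claim[of x0 "k - k0"] k elim D'0 by simp
      also have "\<dots> \<le> (A + C1) * 2 powr (real k * \<beta>)"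
        using A \<beta> \<beta>0 ge_one_powr_ge_zero[of 2 "real k * \<beta>"]
        by (simp add: distrib_right)
      also have "\<dots> \<le> (A + C1) * (2 * ?H powr \<beta>)"
        using A C1 by (intro mult_left_mono dyadic) auto
      finally have "\<bar>u x0\<bar> \<le> 2 * (A + C1) * ?H powr \<beta>" by (simp add: algebra_simps)
      then have "\<bar>u x0\<bar> powr q x0 \<le> (2 * (A + C1) * ?H powr \<beta>) powr q x0"
        using bounds[OF x0] lo by (intro powr_mono2) auto
      also have "\<dots> = (2 * (A + C1)) powr q x0 * ?H powr (q x0 * \<beta>)"
        using A C1 by (simp add: powr_mult powr_powr mult.commute)
      also have "\<dots> \<le> C * ?H powr (p x0 - h)"
        unfolding C_def using A C1 bounds[OF x0] \<beta> H1 by (intro mult_mono powr_mono) auto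
      finally show ?case .
    qed
  qed
  with \<open>C \<ge> 1\<close> T h show ?thesis by blast
qed

section \<open>Boundedness and total boundedness of modulars\<close>

text \<open>By \<open>pointwise_bound\<close>, the modular of \<open>u\<close> in \<open>L\<^sup>q\<close> is at most a constant \<open>K\<close>; dividing \<open>u\<close> by
\<open>K powr (1 / lo)\<close> brings it down to 1.\<close>
lemma modular_bound:
  "\<exists>\<Lambda>\<ge>1. \<forall>u g. admissible u g \<longrightarrow> (\<integral>\<^sup>+x. ennreal ((\<bar>u x\<bar> / \<Lambda>) powr q x) \<partial>M) \<le> 1"
proof -
  obtain C T h where C: "C \<ge> 1" and T: "T \<ge> 1" and h: "h > 0" "h \<le> lo"
    and bound: "\<forall>u g. admissible u g \<longrightarrow>
      (AE x in M. \<bar>u x\<bar> powr q x \<le> C * max T (g x) powr (p x - h))"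
    using pointwise_bound by auto
  define K where "K = C * (T powr hi * measure M UNIV + 1)"
  have "1 * 1 \<le> K"
    unfolding K_def using C measure_positive by (intro mult_mono) auto
  then have K: "1 \<le> K" by simp
  define \<Lambda> where "\<Lambda> = K powr (1 / lo)"
  have \<Lambda>: "1 \<le> \<Lambda>" unfolding \<Lambda>_def using K lo by (intro ge_one_powr_ge_zero) auto
  have \<Lambda>K: "\<Lambda> powr lo = K" unfolding \<Lambda>_def using K lo by (simp add: powr_powr)
  have "(\<integral>\<^sup>+x. ennreal ((\<bar>u x\<bar> / \<Lambda>) powr q x) \<partial>M) \<le> 1" if ug: "admissible u g" for u g
  proof -
    from ug have [measurable]: "g \<in> borel_measurable M"
      and gpos: "\<And>x. 0 \<le> g x"
      and g1: "(\<integral>\<^sup>+x. ennreal (g x powr p x) \<partial>M) \<le> 1"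
      unfolding admissible_def by auto
    have "AE x in M. ennreal ((\<bar>u x\<bar> / \<Lambda>) powr q x) \<le> ennreal (C / K) * (ennreal (T powr hi) + ennreal (g x powr p x))"
      using AE_G bound[rule_format, OF ug]
    proof eventually_elim
      case (elim x)
      note bd = bounds[OF elim(1)]
      have "max T (g x) powr (p x - h) \<le> max T (g x) powr p x"
        using h T by (intro powr_mono) auto
      also have "max T (g x) powr p x \<le> T powr hi + g x powr p x"
      proof (cases "g x \<le> T")
        case True
        then show ?thesis
          using T bd powr_mono[of "p x" hi T] by (simp add: max_def add_increasing2)
      qed (simp add: max_def)
      finally have max_le: "max T (g x) powr (p x - h) \<le> T powr hi + g x powr p x" .
      have "(\<bar>u x\<bar> / \<Lambda>) powr q x = \<bar>u x\<bar> powr q x / \<Lambda> powr q x"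
        using \<Lambda> by (simp add: powr_divide)
      also have "\<dots> \<le> (C * max T (g x) powr (p x - h)) / \<Lambda> powr lo"
        using elim \<Lambda> bd C by (intro frac_le powr_mono) auto
      also have "\<dots> = C / K * max T (g x) powr (p x - h)" unfolding \<Lambda>K by simp
      also have "\<dots> \<le> C / K * (T powr hi + g x powr p x)"
        using C K by (intro mult_left_mono max_le) auto
      finally have "(\<bar>u x\<bar> / \<Lambda>) powr q x \<le> C / K * (T powr hi + g x powr p x)" .
      then have "ennreal ((\<bar>u x\<bar> / \<Lambda>) powr q x) \<le> ennreal (C / K * (T powr hi + g x powr p x))"
        by (rule ennreal_leI)
      also have "\<dots> = ennreal (C / K) * (ennreal (T powr hi) + ennreal (g x powr p x))"
        using C K by (subst ennreal_mult) (auto simp: ennreal_plus)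
      finally show ?case .
    qed
    then have "(\<integral>\<^sup>+x. ennreal ((\<bar>u x\<bar> / \<Lambda>) powr q x) \<partial>M) \<le>
      (\<integral>\<^sup>+x. ennreal (C / K) * (ennreal (T powr hi) + ennreal (g x powr p x)) \<partial>M)"
      by (rule nn_integral_mono_AE)
    also have "\<dots> = ennreal (C / K) * (ennreal (T powr hi) * emeasure M UNIV + (\<integral>\<^sup>+x. ennreal (g x powr p x) \<partial>M))"
      by (subst nn_integral_cmult, measurable) (simp add: nn_integral_add)
    also have "\<dots> \<le> ennreal (C / K) * (ennreal (T powr hi) * emeasure M UNIV + 1)"
      by (intro mult_left_mono add_mono g1) auto
    also have "\<dots> = ennreal (C / K * (T powr hi * measure M UNIV + 1))"
    proof -
      have "ennreal (T powr hi) * ennreal (measure M UNIV) + 1 = ennreal (T powr hi * measure M UNIV + 1)"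
        by (simp add: ennreal_mult ennreal_plus)
      then show ?thesis
        using C K unfolding emeasure_eq_measure by (simp only:, subst ennreal_mult) auto
    qed
    also have "C / K * (T powr hi * measure M UNIV + 1) = 1"
    proof -
      have "C / K * (T powr hi * measure M UNIV + 1) = K / K"
        by (simp only: times_divide_eq_left K_def[symmetric])
      also have "K / K = 1" using K by simp
      finally show ?thesis .
    qed
    finally show ?thesis by simp
  qed
  with \<Lambda> show ?thesis by blast
qed

text \<open>The parameters are fixed one after the other: the level \<open>L\<close> makes the contribution of the large
gradients small, the accuracy \<open>\<eta>\<close> makes the contribution of the level sets small, and the mesh
\<open>\<omega>\<close> of the cover makes the oscillation on \<open>{g \<le> L}\<close> over a cell at most \<open>\<eta>\<close>. The sets \<open>{g \<le> L}\<close> depend on the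
function, so the value recorded for a cell is taken at a point of the cell that lies in this set.\<close>
lemma totally_bounded_modular:
  fixes u g :: "'b \<Rightarrow> 'a \<Rightarrow> real"
  assumes adm: "\<And>i. i \<in> I \<Longrightarrow> admissible (u i) (g i)"
    and \<tau>: "0 < \<tau>" "\<tau> \<le> 1"
  shows "\<exists>F\<subseteq>I. finite F \<and>
    (\<forall>i\<in>I. \<exists>j\<in>F. (\<integral>\<^sup>+x. ennreal ((\<bar>u i x - u j x\<bar> / \<tau>) powr q x) \<partial>M) \<le> 1)"
proof -
  obtain C T h where C: "C \<ge> 1" and T: "T \<ge> 1" and h: "h > 0" "h \<le> lo"
    and bound: "\<forall>u g. admissible u g \<longrightarrow>
      (AE x in M. \<bar>u x\<bar> powr q x \<le> C * max T (g x) powr (p x - h))"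
    using pointwise_bound by auto
  have "\<forall>i\<in>I. \<exists>H. H \<subseteq> G \<and> (AE x in M. x \<in> H) \<and>
     (\<forall>x\<in>H. \<forall>y\<in>H. \<bar>u i x - u i y\<bar> \<le> dist x y powr s x * g i x + dist x y powr s y * g i y) \<and>
     (\<forall>x\<in>H. \<bar>u i x\<bar> powr q x \<le> C * max T (g i x) powr (p x - h))"
  proof
    fix i assume i: "i \<in> I"
    obtain N where N: "N \<in> null_sets M"
      and grad: "\<forall>x\<in>-N. \<forall>y\<in>-N.
        \<bar>u i x - u i y\<bar> \<le> dist x y powr s x * g i x + dist x y powr s y * g i y"
      using adm[OF i] unfolding admissible_def by blast
    show "\<exists>H. H \<subseteq> G \<and> (AE x in M. x \<in> H) \<and>
     (\<forall>x\<in>H. \<forall>y\<in>H. \<bar>u i x - u i y\<bar> \<le> dist x y powr s x * g i x + dist x y powr s y * g i y) \<and>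
     (\<forall>x\<in>H. \<bar>u i x\<bar> powr q x \<le> C * max T (g i x) powr (p x - h))"
    proof (intro exI[of _ "{x \<in> G - N. \<bar>u i x\<bar> powr q x \<le> C * max T (g i x) powr (p x - h)}"] conjI)
      show "AE x in M. x \<in> {x \<in> G - N. \<bar>u i x\<bar> powr q x \<le> C * max T (g i x) powr (p x - h)}"
        using AE_G AE_not_in[OF N] bound[rule_format, OF adm[OF i]]
        by eventually_elim auto
    qed (use grad in auto)
  qed
  from bchoice[OF this] obtain H where
    all: "\<forall>i\<in>I. H i \<subseteq> G \<and> (AE x in M. x \<in> H i) \<and>
     (\<forall>x\<in>H i. \<forall>y\<in>H i. \<bar>u i x - u i y\<bar> \<le> dist x y powr s x * g i x + dist x y powr s y * g i y) \<and>
     (\<forall>x\<in>H i. \<bar>u i x\<bar> powr q x \<le> C * max T (g i x) powr (p x - h))" ..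
  have HG: "\<And>i. i \<in> I \<Longrightarrow> H i \<subseteq> G" and H: "\<And>i. i \<in> I \<Longrightarrow> AE x in M. x \<in> H i"
    and grad: "\<And>i x y. i \<in> I \<Longrightarrow> x \<in> H i \<Longrightarrow> y \<in> H i \<Longrightarrow>
        \<bar>u i x - u i y\<bar> \<le> dist x y powr s x * g i x + dist x y powr s y * g i y"
    and ubound: "\<And>i x. i \<in> I \<Longrightarrow> x \<in> H i \<Longrightarrow> \<bar>u i x\<bar> powr q x \<le> C * max T (g i x) powr (p x - h)"
    using all by blast+
  \<comment> \<open>The choice of \<open>L\<close> gives \<open>2 * C * c / w powr h \<le> 1 / 4\<close> for every \<open>w \<ge> L\<close>; the two gradients
    together then contribute at most \<open>1 / 2\<close> to the modular.\<close>
  define c where "c = (2 / \<tau>) powr hi"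
  have c: "c > 0" unfolding c_def using \<tau> by simp
  define L where "L = max T ((8 * C * c) powr (1 / h))"
  have L: "L \<ge> T" "L \<ge> 1" unfolding L_def using T by auto
  have "8 * C * c = ((8 * C * c) powr (1 / h)) powr h"
    using h C c by (simp add: powr_powr)
  also have "\<dots> \<le> L powr h"
    unfolding L_def using h by (intro powr_mono2) auto
  finally have Lh: "8 * C * c \<le> L powr h" .
  define m where "m = measure M UNIV"
  have m: "m > 0" unfolding m_def by (rule measure_positive)
  \<comment> \<open>\<open>3 * \<eta> / \<tau> = \<kappa>\<close> bounds the quotient in the modular on the common level set, whose contribution
    is at most \<open>\<kappa> powr lo * m \<le> 1 / 2\<close>.\<close>
  define \<kappa> where "\<kappa> = min 1 ((1 / (2 * m)) powr (1 / lo))"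
  have \<kappa>: "0 < \<kappa>" "\<kappa> \<le> 1" unfolding \<kappa>_def using m by auto
  have "\<kappa> powr lo \<le> ((1 / (2 * m)) powr (1 / lo)) powr lo"
    using lo \<kappa> by (intro powr_mono2) (auto simp: \<kappa>_def)
  also have "\<dots> = 1 / (2 * m)" using lo m by (simp add: powr_powr)
  finally have \<kappa>m: "\<kappa> powr lo * m \<le> 1 / 2" using m by (simp add: field_simps)
  define \<eta> where "\<eta> = \<tau> * \<kappa> / 3"
  have \<eta>: "\<eta> > 0" unfolding \<eta>_def using \<tau> \<kappa> by simp
  define \<omega> where "\<omega> = min 1 ((\<eta> / (2 * L)) powr (1 / lo))"
  have \<omega>: "0 < \<omega>" "\<omega> \<le> 1" unfolding \<omega>_def using \<eta> L by auto
  have "\<omega> powr lo \<le> ((\<eta> / (2 * L)) powr (1 / lo)) powr lo"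
    using lo \<omega> by (intro powr_mono2) (auto simp: \<omega>_def)
  also have "\<dots> = \<eta> / (2 * L)" using lo \<eta> L by (simp add: powr_powr)
  finally have \<omega>L: "2 * L * \<omega> powr lo \<le> \<eta>" using L by (simp add: field_simps)
  obtain K :: "'a set" where K: "finite K" "UNIV \<subseteq> (\<Union>a\<in>K. {y. dist a y < \<omega> / 2})"
    using totally_bounded \<omega> unfolding totally_bounded_metric by (meson half_gt_zero)
  define E where "E i = {x \<in> H i. g i x \<le> L}" for i
  have oscillation: "\<bar>u i x - u i y\<bar> \<le> \<eta>"
    if "i \<in> I" "x \<in> E i" "y \<in> E i" "dist a x < \<omega> / 2" "dist a y < \<omega> / 2" for i x y a
  proof -
    have xy: "x \<in> H i" "y \<in> H i" "x \<in> G" "y \<in> G" "g i x \<le> L" "g i y \<le> L"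
      using that HG by (auto simp: E_def)
    have gpos: "0 \<le> g i x" "0 \<le> g i y" using adm[OF that(1)] by (auto simp: admissible_def)
    have d: "dist x y \<le> \<omega>" using dist_triangle3[of x y a] that by linarith
    have pw: "dist x y powr s w \<le> \<omega> powr lo" if "w \<in> G" for w
    proof -
      have "dist x y powr s w \<le> \<omega> powr s w"
        using d bounds[OF that] lo by (intro powr_mono2) auto
      also have "\<dots> \<le> \<omega> powr lo" using \<omega> bounds[OF that] by (intro powr_mono') auto
      finally show ?thesis .
    qed
    have "\<bar>u i x - u i y\<bar> \<le> dist x y powr s x * g i x + dist x y powr s y * g i y"
      using grad that(1) xy by auto
    also have "\<dots> \<le> \<omega> powr lo * L + \<omega> powr lo * L"
      using xy gpos by (intro add_mono mult_mono pw) auto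
    also have "\<dots> \<le> \<eta>" using \<omega>L by (simp add: algebra_simps)
    finally show ?thesis .
  qed
  define B where "B = (C * L powr hi) powr (1 / lo)"
  have CL: "C * L powr hi \<ge> 1"
    using C L hi mult_mono[of 1 C 1 "L powr hi"] ge_one_powr_ge_zero[of L hi] by auto
  then have B1: "B \<ge> 1" unfolding B_def using lo by (intro ge_one_powr_ge_zero) auto
  have u_le_B: "\<bar>u i x\<bar> \<le> B" if "i \<in> I" "x \<in> E i" for i x
  proof (rule ccontr)
    assume "\<not> ?thesis"
    then have uB: "B < \<bar>u i x\<bar>" by simp
    have x: "x \<in> H i" "x \<in> G" "g i x \<le> L" using that HG by (auto simp: E_def)
    note bd = bounds[OF x(2)]
    have "C * L powr hi = B powr lo" unfolding B_def using CL lo by (simp add: powr_powr)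
    also have "\<dots> < \<bar>u i x\<bar> powr lo" using uB B1 lo by (intro powr_less_mono2) auto
    also have "\<dots> \<le> \<bar>u i x\<bar> powr q x" using uB B1 bd by (intro powr_mono) auto
    also have "\<dots> \<le> C * max T (g i x) powr (p x - h)" using ubound that(1) x(1) .
    also have "\<dots> \<le> C * max T (g i x) powr hi"
      using C T h bd by (intro mult_left_mono powr_mono) auto
    also have "\<dots> \<le> C * L powr hi"
      using C T L x hi by (intro mult_left_mono powr_mono2) auto
    finally show False by simp
  qed
  \<comment> \<open>The code 0 of a cell without points of \<open>E i\<close> is a default value: two functions are compared
    only at points of both level sets.\<close>
  define cell where "cell i a = E i \<inter> ball a (\<omega> / 2)" for i a
  define code where "code i = (\<lambda>a\<in>K. if cell i a = {} then 0 else \<lfloor>u i (SOME z. z \<in> cell i a) / \<eta>\<rfloor>)" for i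
  have code_range: "code ` I \<subseteq> K \<rightarrow>\<^sub>E {- \<lceil>B / \<eta>\<rceil>..\<lceil>B / \<eta>\<rceil>}"
  proof (rule image_subsetI, rule PiE_I)
    fix i a assume i: "i \<in> I" and a: "a \<in> K"
    have "0 \<le> B / \<eta>" using B1 \<eta> by simp
    then have B0: "0 \<le> \<lceil>B / \<eta>\<rceil>" by linarith
    show "code i a \<in> {- \<lceil>B / \<eta>\<rceil>..\<lceil>B / \<eta>\<rceil>}"
    proof (cases "cell i a = {}")
      case False
      define z where "z = (SOME z. z \<in> cell i a)"
      have "z \<in> cell i a" unfolding z_def using False some_in_eq by blast
      then have "\<bar>u i z\<bar> \<le> B" using u_le_B i by (auto simp: cell_def)
      then have "- B / \<eta> \<le> u i z / \<eta>" "u i z / \<eta> \<le> B / \<eta>"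
        using \<eta> by (intro divide_right_mono; linarith)+
      then have "- (B / \<eta>) \<le> u i z / \<eta>" "u i z / \<eta> \<le> B / \<eta>" by simp_all
      moreover have "code i a = \<lfloor>u i z / \<eta>\<rfloor>" using a False by (simp add: code_def z_def)
      ultimately show ?thesis unfolding atLeastAtMost_iff by linarith
    qed (use a B0 in \<open>auto simp: code_def\<close>)
  qed (auto simp: code_def)
  have same_code: "\<bar>u i x - u j x\<bar> \<le> 3 * \<eta>"
    if ij: "i \<in> I" "j \<in> I" "code i = code j" and x: "x \<in> E i" "x \<in> E j" for i j x
  proof -
    obtain a where a: "a \<in> K" "dist a x < \<omega> / 2" using K(2) by blast
    define zi where "zi = (SOME z. z \<in> cell i a)"
    define zj where "zj = (SOME z. z \<in> cell j a)"
    have ne: "cell i a \<noteq> {}" "cell j a \<noteq> {}" using x a by (auto simp: cell_def)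
    then have z: "zi \<in> cell i a" "zj \<in> cell j a"
      unfolding zi_def zj_def using some_in_eq by blast+
    have "code i a = code j a" using ij by simp
    then have "\<lfloor>u i zi / \<eta>\<rfloor> = \<lfloor>u j zj / \<eta>\<rfloor>"
      using a ne by (simp add: code_def zi_def zj_def)
    then have "\<bar>u i zi / \<eta> - u j zj / \<eta>\<bar> \<le> 1" by linarith
    then have "\<bar>u i zi - u j zj\<bar> \<le> \<eta>"
      using \<eta> by (simp add: diff_divide_distrib[symmetric] abs_divide divide_le_eq)
    moreover have "\<bar>u i x - u i zi\<bar> \<le> \<eta>"
      using oscillation[of i x zi a] ij x a z by (auto simp: cell_def)
    moreover have "\<bar>u j x - u j zj\<bar> \<le> \<eta>"
      using oscillation[of j x zj a] ij x a z by (auto simp: cell_def)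
    ultimately show ?thesis by linarith
  qed
  have close: "(\<integral>\<^sup>+x. ennreal ((\<bar>u i x - u j x\<bar> / \<tau>) powr q x) \<partial>M) \<le> 1"
    if ij: "i \<in> I" "j \<in> I" "code i = code j" for i j
  proof -
    from adm[OF ij(1)] adm[OF ij(2)]
    have [measurable]: "g i \<in> borel_measurable M" "g j \<in> borel_measurable M"
      and gpos: "\<And>x. 0 \<le> g i x" "\<And>x. 0 \<le> g j x"
      and g1: "(\<integral>\<^sup>+x. ennreal (g i x powr p x) \<partial>M) \<le> 1" "(\<integral>\<^sup>+x. ennreal (g j x powr p x) \<partial>M) \<le> 1"
      unfolding admissible_def by auto
    have "AE x in M. ennreal ((\<bar>u i x - u j x\<bar> / \<tau>) powr q x) \<le>
      ennreal (\<kappa> powr lo) + ennreal (1 / 4) * (ennreal (g i x powr p x) + ennreal (g j x powr p x))"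
      using H[OF ij(1)] H[OF ij(2)]
    proof eventually_elim
      case (elim x)
      then have x: "x \<in> G" using HG ij by auto
      note bd = bounds[OF x]
      have "(\<bar>u i x - u j x\<bar> / \<tau>) powr q x \<le> \<kappa> powr lo + 1 / 4 * (g i x powr p x + g j x powr p x)"
      proof (cases "x \<in> E i \<and> x \<in> E j")
        case True
        then have "\<bar>u i x - u j x\<bar> \<le> 3 * \<eta>" using same_code ij by blast
        then have "\<bar>u i x - u j x\<bar> / \<tau> \<le> \<kappa>"
          unfolding \<eta>_def using \<tau> by (simp add: divide_le_eq mult.commute)
        then have "(\<bar>u i x - u j x\<bar> / \<tau>) powr q x \<le> \<kappa> powr q x"
          using \<tau> bd lo by (intro powr_mono2) auto
        also have "\<dots> \<le> \<kappa> powr lo" using \<kappa> bd by (intro powr_mono') auto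
        finally show ?thesis by (simp add: add_increasing2)
      next
        case False
        define w where "w = max (g i x) (g j x)"
        have w: "L < w" using False elim by (auto simp: E_def w_def)
        have le: "\<bar>u k x\<bar> powr q x \<le> C * w powr (p x - h)"
          if "k \<in> I" "x \<in> H k" "g k x \<le> w" for k
        proof -
          have "\<bar>u k x\<bar> powr q x \<le> C * max T (g k x) powr (p x - h)" using ubound that(1,2) .
          also have "\<dots> \<le> C * w powr (p x - h)"
            using C T L w h bd that(3) by (intro mult_left_mono powr_mono2) auto
          finally show ?thesis .
        qed
        have "(\<bar>u i x - u j x\<bar> / \<tau>) powr q x \<le> c * (\<bar>u i x\<bar> powr q x + \<bar>u j x\<bar> powr q x)"
          unfolding c_def using powr_diff_le \<tau> bd lo by auto
        also have "\<dots> \<le> c * (C * w powr (p x - h) + C * w powr (p x - h))"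
          using c ij elim by (intro mult_left_mono add_mono le) (auto simp: w_def)
        also have "\<dots> = 2 * C * c / w powr h * w powr p x"
          by (simp add: powr_diff)
        also have "\<dots> \<le> 1 / 4 * w powr p x"
        proof (rule mult_right_mono)
          have "L powr h \<le> w powr h" using w L h by (intro powr_mono2) auto
          with Lh have "8 * C * c \<le> w powr h" by linarith
          then show "2 * C * c / w powr h \<le> 1 / 4" using w L by (simp add: divide_le_eq)
        qed simp
        also have "w powr p x \<le> g i x powr p x + g j x powr p x"
          by (simp add: w_def max_def)
        finally have "(\<bar>u i x - u j x\<bar> / \<tau>) powr q x \<le> 1 / 4 * (g i x powr p x + g j x powr p x)"
          by simp
        moreover have "0 \<le> \<kappa> powr lo" by simp
        ultimately show ?thesis by linarith
      qed
      then have "ennreal ((\<bar>u i x - u j x\<bar> / \<tau>) powr q x) \<le>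
        ennreal (\<kappa> powr lo + 1 / 4 * (g i x powr p x + g j x powr p x))"
        by (rule ennreal_leI)
      also have "\<dots> = ennreal (\<kappa> powr lo) + ennreal (1 / 4) * (ennreal (g i x powr p x) + ennreal (g j x powr p x))"
        by (simp add: ennreal_plus[symmetric] ennreal_mult[symmetric] del: ennreal_plus)
      finally show ?case .
    qed
    then have "(\<integral>\<^sup>+x. ennreal ((\<bar>u i x - u j x\<bar> / \<tau>) powr q x) \<partial>M) \<le>
      (\<integral>\<^sup>+x. ennreal (\<kappa> powr lo) + ennreal (1 / 4) * (ennreal (g i x powr p x) + ennreal (g j x powr p x)) \<partial>M)"
      by (rule nn_integral_mono_AE)
    also have "\<dots> = ennreal (\<kappa> powr lo) * emeasure M UNIV + ennreal (1 / 4) *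
        ((\<integral>\<^sup>+x. ennreal (g i x powr p x) \<partial>M) + (\<integral>\<^sup>+x. ennreal (g j x powr p x) \<partial>M))"
      by (subst nn_integral_add, measurable, subst nn_integral_cmult, measurable) (simp add: nn_integral_add)
    also have "\<dots> \<le> ennreal (\<kappa> powr lo) * ennreal m + ennreal (1 / 4) * (1 + 1)"
      unfolding m_def emeasure_eq_measure[symmetric] by (intro add_mono mult_left_mono g1) auto
    also have "\<dots> = ennreal (\<kappa> powr lo * m + 1 / 2)"
    proof -
      have "ennreal y * ennreal m + ennreal z * (1 + 1) = ennreal (y * m + z * 2)"
        if "0 \<le> y" "0 \<le> z" for y z
        using that m by (simp add: ennreal_plus ennreal_mult)
      from this[of "\<kappa> powr lo" "1 / 4"] show ?thesis by simp
    qed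
    also have "\<dots> \<le> ennreal 1" using \<kappa>m by (intro ennreal_leI) simp
    finally show ?thesis by simp
  qed
  have "finite (code ` I)"
    using code_range by (rule finite_subset) (intro finite_PiE K(1), auto)
  then obtain F where F: "F \<subseteq> I" "finite F" "code ` I = code ` F"
    using finite_subset_image[of "code ` I" code I] by auto
  show ?thesis
  proof (intro exI[of _ F] conjI ballI)
    fix i assume i: "i \<in> I"
    then obtain j where "j \<in> F" "code i = code j" using F(3) by blast
    then show "\<exists>j\<in>F. (\<integral>\<^sup>+x. ennreal ((\<bar>u i x - u j x\<bar> / \<tau>) powr q x) \<partial>M) \<le> 1"
      using close i F(1) by blast
  qed (use F in auto)
qed

end

section \<open>From extended-real to real exponents\<close>

lemma AE_essinf_le: "AE x in M. essinf M f \<le> f x"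
  using esssup_AE[of "\<lambda>x. - f x" M]
  by eventually_elim (simp add: essinf_def ereal_uminus_le_reorder)

lemma AE_positive_lower_bound:
  assumes "0 < essinf M f"
  obtains l where "0 < l" "AE x in M. ereal l \<le> f x"
proof -
  obtain l where l: "0 < ereal l" "ereal l < essinf M f"
    using ereal_dense2[OF assms] by auto
  have "AE x in M. ereal l \<le> f x"
    using AE_essinf_le[of M f] by eventually_elim (use l in auto)
  with l show ?thesis by (intro that[of l]) auto
qed

lemma bounded_exponents_AE_bounds:
  assumes "p \<in> bounded_exponents M"
  obtains l h where "0 < l" "AE x in M. ereal l \<le> p x \<and> p x \<le> ereal h"
proof -
  obtain l where l: "0 < l" "AE x in M. ereal l \<le> p x"
    using assms AE_positive_lower_bound[of M p] by (auto simp: bounded_exponents_def exponents_def)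
  obtain h where h: "esssup M p < ereal h"
    using assms ereal_dense2[of "esssup M p" \<infinity>] by (auto simp: bounded_exponents_def)
  have "AE x in M. ereal l \<le> p x \<and> p x \<le> ereal h"
    using l(2) esssup_AE[of p M] by eventually_elim (use h in auto)
  with l(1) show ?thesis by (rule that)
qed

lemma modular_divide_eq:
  assumes l: "l > 0" and u: "AE x in M. \<bar>u x\<bar> \<noteq> \<infinity>" and P: "AE x in M. P x = ereal (p x)"
  shows "modular M P (\<lambda>x. u x / ereal l) = (\<integral>\<^sup>+x. ennreal ((\<bar>real_of_ereal (u x)\<bar> / l) powr p x) \<partial>M)"
  unfolding modular_def
proof (rule nn_integral_cong_AE)
  show "AE x in M. e2ennreal (epowr \<bar>u x / ereal l\<bar> (P x)) = ennreal ((\<bar>real_of_ereal (u x)\<bar> / l) powr p x)"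
    using u P
  proof eventually_elim
    case (elim x)
    then obtain r where "u x = ereal r" by (cases "u x") auto
    with elim l show ?case by (simp add: epowr_def)
  qed
qed

text \<open>A gradient may take the value \<open>\<infinity>\<close>. A finite modular excludes this almost everywhere, because at
almost every point the exponent is finite, and there \<open>epowr \<infinity>\<close> is \<open>\<infinity>\<close>.\<close>
lemma AE_finite_of_modular:
  assumes [measurable]: "g \<in> borel_measurable M"
    and P: "AE x in M. P x = ereal (p x)" and l: "l > 0"
    and fin: "modular M P (\<lambda>x. g x / ereal l) < \<infinity>"
  shows "AE x in M. \<bar>g x\<bar> \<noteq> \<infinity>"
proof -
  let ?S = "{x \<in> space M. \<bar>g x\<bar> = \<infinity>}"
  have [measurable]: "?S \<in> sets M" by measurable
  have "\<infinity> * emeasure M ?S = (\<integral>\<^sup>+x. \<infinity> * indicator ?S x \<partial>M)"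
    by (simp add: nn_integral_cmult_indicator)
  also have "\<dots> \<le> modular M P (\<lambda>x. g x / ereal l)"
    unfolding modular_def
  proof (rule nn_integral_mono_AE)
    show "AE x in M. \<infinity> * indicator ?S x \<le> e2ennreal (epowr \<bar>g x / ereal l\<bar> (P x))"
      using P
    proof eventually_elim
      case (elim x)
      show ?case
      proof (cases "\<bar>g x\<bar> = \<infinity>")
        case True
        then have "\<bar>g x / ereal l\<bar> = \<infinity>" using l by (cases "g x") auto
        then show ?thesis using elim by (simp add: epowr_def e2ennreal_infty)
      qed simp
    qed
  qed
  finally have "\<infinity> * emeasure M ?S < \<infinity>" using fin by simp
  then have "emeasure M ?S = 0" by (auto simp: ennreal_top_mult split: if_splits)
  then have "?S \<in> null_sets M" by auto
  then show ?thesis by (rule AE_I') auto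
qed

context subcritical_exponents begin

lemma modular_le_1_of_norm_less:
  assumes w: "AE x in M. \<bar>w x\<bar> \<noteq> \<infinity>" and P: "AE x in M. P x = ereal (p x)"
    and less: "Lebesgue_norm M P w < ennreal L"
  shows "(\<integral>\<^sup>+x. ennreal (\<bar>real_of_ereal (w x) / L\<bar> powr p x) \<partial>M) \<le> 1"
proof -
  obtain l where l: "l > 0" "modular M P (\<lambda>x. w x / ereal l) \<le> 1" "ennreal l < ennreal L"
    using less unfolding Lebesgue_norm_def INF_less_iff by auto
  then have lL: "l < L" by (simp add: ennreal_less_iff)
  have quotient: "\<bar>t / L\<bar> powr e \<le> (\<bar>t\<bar> / l) powr e" if "0 \<le> e" for t e :: real
    using that l lL by (intro powr_mono2) (simp_all add: abs_divide frac_le)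
  have "(\<integral>\<^sup>+x. ennreal (\<bar>real_of_ereal (w x) / L\<bar> powr p x) \<partial>M) \<le>
    (\<integral>\<^sup>+x. ennreal ((\<bar>real_of_ereal (w x)\<bar> / l) powr p x) \<partial>M)"
  proof (rule nn_integral_mono_AE)
    show "AE x in M. ennreal (\<bar>real_of_ereal (w x) / L\<bar> powr p x) \<le> ennreal ((\<bar>real_of_ereal (w x)\<bar> / l) powr p x)"
      using AE_G
    proof eventually_elim
      case (elim x)
      show ?case
        using bounds[OF elim] lo by (intro ennreal_leI quotient) auto
    qed
  qed
  also have "\<dots> = modular M P (\<lambda>x. w x / ereal l)"
    by (rule modular_divide_eq[symmetric, OF l(1) w P])
  finally show ?thesis using l by simp
qed

lemma admissible_of_Sobolev_norm_less:
  assumes [measurable]: "u \<in> borel_measurable M" and u: "AE x in M. \<bar>u x\<bar> \<noteq> \<infinity>"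
    and P: "AE x in M. P x = ereal (p x)" and S: "AE x in M. S x = ereal (s x)"
    and L: "L > 0" and less: "Sobolev_norm M S P u < ennreal L"
  shows "\<exists>g. admissible (\<lambda>x. real_of_ereal (u x) / L) g"
proof -
  have "Lebesgue_norm M P u < ennreal L" "Sobolev_seminorm M S P u < ennreal L"
    using less unfolding Sobolev_norm_def
    by (auto elim: order.strict_trans1[rotated])
  then obtain g where "g \<in> scalar_gradients M S u" and gL: "Lebesgue_norm M P g < ennreal L"
    unfolding Sobolev_seminorm_def INF_less_iff by auto
  then obtain N where [measurable]: "g \<in> borel_measurable M" and gpos: "\<And>x. 0 \<le> g x"
    and N: "N \<in> null_sets M"
    and grad: "\<And>x y. x \<in> -N \<Longrightarrow> y \<in> -N \<Longrightarrow>
       \<bar>u x - u y\<bar> \<le> epowr (ereal (dist x y)) (S x) * g x + epowr (ereal (dist x y)) (S y) * g y"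
    unfolding scalar_gradients_def by blast
  obtain l where l: "l > 0" "modular M P (\<lambda>x. g x / ereal l) \<le> 1"
    using gL unfolding Lebesgue_norm_def INF_less_iff by auto
  have g: "AE x in M. \<bar>g x\<bar> \<noteq> \<infinity>"
    using l by (intro AE_finite_of_modular[OF _ P l(1)]) (auto intro: le_less_trans)
  have "AE x in M. x \<notin> N \<and> \<bar>u x\<bar> \<noteq> \<infinity> \<and> \<bar>g x\<bar> \<noteq> \<infinity> \<and> S x = ereal (s x)"
    using AE_not_in[OF N] u g S by eventually_elim auto
  then obtain N' where N': "N' \<in> null_sets M"
    and sub: "{x \<in> space M. \<not> (x \<notin> N \<and> \<bar>u x\<bar> \<noteq> \<infinity> \<and> \<bar>g x\<bar> \<noteq> \<infinity> \<and> S x = ereal (s x))} \<subseteq> N'"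
    unfolding eventually_ae_filter by blast
  have good: "x \<notin> N \<and> \<bar>u x\<bar> \<noteq> \<infinity> \<and> \<bar>g x\<bar> \<noteq> \<infinity> \<and> S x = ereal (s x)" if "x \<in> - N'" for x
  proof (rule ccontr)
    assume "\<not> ?thesis"
    then have "x \<in> N'" by (intro subsetD[OF sub] CollectI conjI) (simp_all only: space_M UNIV_I not_False_eq_True)
    with that show False by simp
  qed
  have "admissible (\<lambda>x. real_of_ereal (u x) / L) (\<lambda>x. real_of_ereal (g x) / L)"
    unfolding admissible_def
  proof (intro conjI allI bexI[OF _ N'] ballI)
    show "(\<lambda>x. real_of_ereal (u x) / L) \<in> borel_measurable M"
      "(\<lambda>x. real_of_ereal (g x) / L) \<in> borel_measurable M" by measurable
    show "0 \<le> real_of_ereal (g x) / L" for x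
      using gpos L by (simp add: real_of_ereal_pos)
    then have "\<bar>real_of_ereal (g x) / L\<bar> = real_of_ereal (g x) / L" for x by (rule abs_of_nonneg)
    with modular_le_1_of_norm_less[OF g P gL]
    show "(\<integral>\<^sup>+x. ennreal ((real_of_ereal (g x) / L) powr p x) \<partial>M) \<le> 1" by simp
    show "(\<integral>\<^sup>+x. ennreal (\<bar>real_of_ereal (u x) / L\<bar> powr p x) \<partial>M) \<le> 1"
      by (rule modular_le_1_of_norm_less[OF u P]) fact
    fix x y assume xy: "x \<in> - N'" "y \<in> - N'"
    obtain a b c d where r: "u x = ereal a" "u y = ereal b" "g x = ereal c" "g y = ereal d"
      using good[OF xy(1)] good[OF xy(2)] by (metis ereal_cases abs_ereal.simps(2,3))
    have "\<bar>a - b\<bar> \<le> dist x y powr s x * c + dist x y powr s y * d"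
      using grad[of x y] good[OF xy(1)] good[OF xy(2)] r by (simp add: epowr_def)
    then have "\<bar>a - b\<bar> / L \<le> (dist x y powr s x * c + dist x y powr s y * d) / L"
      using L by (intro divide_right_mono) auto
    then show "\<bar>real_of_ereal (u x) / L - real_of_ereal (u y) / L\<bar> \<le>
      dist x y powr s x * (real_of_ereal (g x) / L) + dist x y powr s y * (real_of_ereal (g y) / L)"
      using L by (simp add: r diff_divide_distrib[symmetric] add_divide_distrib abs_divide)
  qed
  then show ?thesis by blast
qed

lemma Lebesgue_norm_le:
  assumes "AE x in M. \<bar>w x\<bar> \<noteq> \<infinity>" "AE x in M. P x = ereal (r x)" "l > 0"
    "(\<integral>\<^sup>+x. ennreal ((\<bar>real_of_ereal (w x)\<bar> / l) powr r x) \<partial>M) \<le> 1"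
  shows "Lebesgue_norm M P w \<le> ennreal l"
  unfolding Lebesgue_norm_def
  by (rule INF_lower) (use assms modular_divide_eq[OF assms(3,1,2)] in simp)

text \<open>Some multiple of \<open>w\<close> has finite modular \<open>K\<close>; since \<open>p \<ge> lo > 0\<close>, a further division by
\<open>K powr (1 / lo)\<close>, if \<open>K \<ge> 1\<close>, makes the modular at most 1.\<close>
lemma Lebesgue_norm_finite:
  assumes w: "AE x in M. \<bar>w x\<bar> \<noteq> \<infinity>" and [measurable]: "w \<in> borel_measurable M"
    and P: "AE x in M. P x = ereal (p x)"
    and "w \<in> Lebesgue_space M P"
  shows "Lebesgue_norm M P w < \<infinity>"
proof -
  obtain k where k: "k > 0" "modular M P (\<lambda>x. ereal k * w x) < \<infinity>"
    using assms unfolding Lebesgue_space_def by auto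
  define l where "l = 1 / k"
  have l: "l > 0" unfolding l_def using k by simp
  have "(\<lambda>x. ereal k * w x) = (\<lambda>x. w x / ereal l)"
    using k by (auto simp: l_def divide_ereal_def mult.commute)
  then have "modular M P (\<lambda>x. w x / ereal l) < \<infinity>" using k by simp
  then have fin: "(\<integral>\<^sup>+x. ennreal ((\<bar>real_of_ereal (w x)\<bar> / l) powr p x) \<partial>M) < \<infinity>"
    unfolding modular_divide_eq[OF l w P] .
  then obtain K where K: "K \<ge> 0" "(\<integral>\<^sup>+x. ennreal ((\<bar>real_of_ereal (w x)\<bar> / l) powr p x) \<partial>M) = ennreal K"
    by (cases "\<integral>\<^sup>+x. ennreal ((\<bar>real_of_ereal (w x)\<bar> / l) powr p x) \<partial>M") auto
  define c where "c = max 1 K powr (1 / lo)"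
  have c: "c \<ge> 1" unfolding c_def using lo by (intro ge_one_powr_ge_zero) auto
  have clo: "c powr lo = max 1 K" unfolding c_def using lo by (simp add: powr_powr)
  have "(\<integral>\<^sup>+x. ennreal ((\<bar>real_of_ereal (w x)\<bar> / (l * c)) powr p x) \<partial>M) \<le>
    (\<integral>\<^sup>+x. ennreal (1 / max 1 K) * ennreal ((\<bar>real_of_ereal (w x)\<bar> / l) powr p x) \<partial>M)"
  proof (rule nn_integral_mono_AE)
    show "AE x in M. ennreal ((\<bar>real_of_ereal (w x)\<bar> / (l * c)) powr p x) \<le>
      ennreal (1 / max 1 K) * ennreal ((\<bar>real_of_ereal (w x)\<bar> / l) powr p x)"
      using AE_G
    proof eventually_elim
      case (elim x)
      have "(\<bar>real_of_ereal (w x)\<bar> / (l * c)) powr p x = (\<bar>real_of_ereal (w x)\<bar> / l) powr p x / c powr p x"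
        using l c by (simp add: powr_divide[symmetric])
      also have "\<dots> \<le> (\<bar>real_of_ereal (w x)\<bar> / l) powr p x / c powr lo"
        using bounds[OF elim] c by (intro divide_left_mono powr_mono) auto
      finally show ?case
        unfolding clo by (simp add: ennreal_mult[symmetric] ennreal_leI)
    qed
  qed
  also have "\<dots> = ennreal (1 / max 1 K) * ennreal K"
    by (subst nn_integral_cmult, measurable) (simp only: K(2))
  also have "\<dots> = ennreal (K / max 1 K)"
    using K by (simp add: ennreal_mult[symmetric])
  also have "\<dots> \<le> ennreal 1" by (intro ennreal_leI) (simp add: divide_le_eq)
  finally have "Lebesgue_norm M P w \<le> ennreal (l * c)"
    using l c by (intro Lebesgue_norm_le[OF w P]) auto
  then show ?thesis by (auto intro: le_less_trans)
qed

text \<open>A function of Sobolev norm below \<open>L\<close> becomes part of an admissible pair when it is divided by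
\<open>L\<close>, so the three parts of the claim are \<open>modular_bound\<close> for \<open>u\<close>, the same for \<open>v - u\<close>, and
\<open>totally_bounded_modular\<close> for the rescaled family.\<close>
lemma compact_embedding:
  fixes P S T :: "'a \<Rightarrow> ereal"
  assumes P: "AE x in M. P x = ereal (p x)" and S: "AE x in M. S x = ereal (s x)"
    and T: "AE x in M. T x = ereal (q x)"
  shows "compactly_embedded (Sobolev_space M S P) (Sobolev_norm M S P)
           (Lebesgue_space M T) (Lebesgue_norm M T)"
  unfolding compactly_embedded_def
proof (intro conjI allI ballI impI)
  obtain \<Lambda> where \<Lambda>: "\<Lambda> \<ge> 1"
    "\<And>u g. admissible u g \<Longrightarrow> (\<integral>\<^sup>+x. ennreal ((\<bar>u x\<bar> / \<Lambda>) powr q x) \<partial>M) \<le> 1"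
    using modular_bound by auto
  have bound: "(\<integral>\<^sup>+x. ennreal ((\<bar>real_of_ereal (u x)\<bar> / (L * \<Lambda>)) powr q x) \<partial>M) \<le> 1"
    if u: "u \<in> borel_measurable M" "AE x in M. \<bar>u x\<bar> \<noteq> \<infinity>"
      and L: "L > 0" "Sobolev_norm M S P u < ennreal L" for u L
  proof -
    obtain g where "admissible (\<lambda>x. real_of_ereal (u x) / L) g"
      using admissible_of_Sobolev_norm_less[OF u P S L] by blast
    from \<Lambda>(2)[OF this] show ?thesis using L(1) by (simp add: abs_divide)
  qed
  have Sobolev: "u \<in> borel_measurable M" "AE x in M. \<bar>u x\<bar> \<noteq> \<infinity>" "Sobolev_norm M S P u < \<infinity>"
    if "u \<in> Sobolev_space M S P" for u
    using that Lebesgue_norm_finite[OF _ _ P, of u]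
    by (auto simp: Sobolev_space_def Sobolev_norm_def Lebesgue_space_def)
  have diff: "(\<lambda>x. v x - u x) \<in> borel_measurable M" "AE x in M. \<bar>v x - u x\<bar> \<noteq> \<infinity>"
    "AE x in M. real_of_ereal (v x - u x) = real_of_ereal (v x) - real_of_ereal (u x)"
    if "u \<in> Sobolev_space M S P" "v \<in> Sobolev_space M S P" for u v
  proof -
    note [measurable] = Sobolev(1)[OF that(1)] Sobolev(1)[OF that(2)]
    show "(\<lambda>x. v x - u x) \<in> borel_measurable M" by measurable
    show "AE x in M. \<bar>v x - u x\<bar> \<noteq> \<infinity>"
      using Sobolev(2)[OF that(1)] Sobolev(2)[OF that(2)] by eventually_elim auto
    show "AE x in M. real_of_ereal (v x - u x) = real_of_ereal (v x) - real_of_ereal (u x)"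
      using Sobolev(2)[OF that(1)] Sobolev(2)[OF that(2)]
      by eventually_elim (auto simp: real_of_ereal_minus)
  qed
  have real_below: "\<exists>r>0. ennreal r < \<epsilon>" if "\<epsilon> > 0" for \<epsilon> :: ennreal
    using dense[OF that] by (metis ennreal_cases ennreal_less_zero_iff not_less_iff_gr_or_eq top_greatest less_top)
  show "Sobolev_space M S P \<subseteq> Lebesgue_space M T"
  proof
    fix u assume u: "u \<in> Sobolev_space M S P"
    obtain L where L: "L > 0" "Sobolev_norm M S P u < ennreal L"
    proof -
      let ?n = "Sobolev_norm M S P u"
      have "?n = ennreal (enn2real ?n)" using Sobolev(3)[OF u] by simp
      also have "\<dots> < ennreal (enn2real ?n + 1)" by (simp add: ennreal_less_iff)
      finally have "?n < ennreal (enn2real ?n + 1)" .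
      moreover have "0 < enn2real ?n + 1" by (rule add_nonneg_pos) simp_all
      ultimately show ?thesis by (intro that)
    qed
    define l where "l = L * \<Lambda>"
    have l: "l > 0" unfolding l_def using L \<Lambda> by simp
    have "modular M T (\<lambda>x. u x / ereal l) \<le> 1"
      using modular_divide_eq[OF l Sobolev(2)[OF u] T] bound[OF Sobolev(1,2)[OF u] L]
      by (simp add: l_def)
    also have "(\<lambda>x. u x / ereal l) = (\<lambda>x. ereal (1 / l) * u x)"
      using l by (auto simp: divide_ereal_def mult.commute inverse_eq_divide)
    finally have "modular M T (\<lambda>x. ereal (1 / l) * u x) < \<infinity>" by (auto intro: le_less_trans)
    then show "u \<in> Lebesgue_space M T"
      using Sobolev(1)[OF u] l unfolding Lebesgue_space_def by (auto intro!: exI[of _ "1 / l"])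
  qed
  show "\<exists>\<delta>>0. \<forall>v\<in>Sobolev_space M S P. Sobolev_norm M S P (\<lambda>x. v x - u x) < \<delta> \<longrightarrow>
      Lebesgue_norm M T (\<lambda>x. v x - u x) < \<epsilon>"
    if u: "u \<in> Sobolev_space M S P" and \<epsilon>: "\<epsilon> > 0" for u \<epsilon>
  proof -
    obtain r where r: "r > 0" "ennreal r < \<epsilon>" using real_below[OF \<epsilon>] by blast
    show ?thesis
    proof (intro exI[of _ "ennreal (r / \<Lambda>)"] conjI ballI impI)
      show "0 < ennreal (r / \<Lambda>)" using r \<Lambda> by simp
      fix v assume v: "v \<in> Sobolev_space M S P" and less: "Sobolev_norm M S P (\<lambda>x. v x - u x) < ennreal (r / \<Lambda>)"
      have "(\<integral>\<^sup>+x. ennreal ((\<bar>real_of_ereal (v x - u x)\<bar> / (r / \<Lambda> * \<Lambda>)) powr q x) \<partial>M) \<le> 1"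
        using r \<Lambda> by (intro bound[OF diff(1,2)[OF u v] _ less]) auto
      then have "Lebesgue_norm M T (\<lambda>x. v x - u x) \<le> ennreal (r / \<Lambda> * \<Lambda>)"
        using r \<Lambda> by (intro Lebesgue_norm_le[OF diff(2)[OF u v] T]) auto
      also have "r / \<Lambda> * \<Lambda> = r" using \<Lambda> by simp
      finally show "Lebesgue_norm M T (\<lambda>x. v x - u x) < \<epsilon>" using r by simp
    qed
  qed
  show "\<exists>F. finite F \<and> F \<subseteq> A \<and> (\<forall>u\<in>A. \<exists>v\<in>F. Lebesgue_norm M T (\<lambda>x. u x - v x) < \<epsilon>)"
    if A: "A \<subseteq> Sobolev_space M S P" and bdd: "\<exists>B<\<infinity>. \<forall>u\<in>A. Sobolev_norm M S P u \<le> B" and \<epsilon>: "\<epsilon> > 0" for A \<epsilon>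
  proof -
    obtain B where B: "B < \<infinity>" "\<And>u. u \<in> A \<Longrightarrow> Sobolev_norm M S P u \<le> B" using bdd by blast
    define L where "L = enn2real B + 1"
    have L: "L > 0" unfolding L_def by (rule add_nonneg_pos) auto
    have "B = ennreal (enn2real B)" using B by simp
    also have "\<dots> < ennreal L" unfolding L_def by (simp add: ennreal_less_iff)
    finally have "Sobolev_norm M S P u < ennreal L" if "u \<in> A" for u
      using B(2)[OF that] by simp
    then have "\<forall>u\<in>A. \<exists>g. admissible (\<lambda>x. real_of_ereal (u x) / L) g"
      using A Sobolev by (intro ballI admissible_of_Sobolev_norm_less[OF _ _ P S L]) auto
    from bchoice[OF this] obtain g where g: "\<And>u. u \<in> A \<Longrightarrow> admissible (\<lambda>x. real_of_ereal (u x) / L) (g u)"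
      by auto
    obtain r where r: "r > 0" "ennreal r < \<epsilon>" using real_below[OF \<epsilon>] by blast
    define \<tau> where "\<tau> = min 1 (r / L)"
    have \<tau>: "0 < \<tau>" "\<tau> \<le> 1" unfolding \<tau>_def using r L by auto
    have "\<tau> * L \<le> r / L * L" unfolding \<tau>_def using L by (intro mult_right_mono) auto
    then have \<tau>L: "L * \<tau> \<le> r" using L by (simp add: mult.commute)
    from totally_bounded_modular[of A "\<lambda>u x. real_of_ereal (u x) / L" g, OF g \<tau>]
    obtain F where F: "F \<subseteq> A" "finite F" and close: "\<And>u. u \<in> A \<Longrightarrow> \<exists>v\<in>F.
      (\<integral>\<^sup>+x. ennreal ((\<bar>real_of_ereal (u x) / L - real_of_ereal (v x) / L\<bar> / \<tau>) powr q x) \<partial>M) \<le> 1"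
      by auto
    show ?thesis
    proof (intro exI[of _ F] conjI ballI)
      fix u assume u: "u \<in> A"
      then obtain v where v: "v \<in> F" and le:
        "(\<integral>\<^sup>+x. ennreal ((\<bar>real_of_ereal (u x) / L - real_of_ereal (v x) / L\<bar> / \<tau>) powr q x) \<partial>M) \<le> 1"
        using close by blast
      have uv: "v \<in> Sobolev_space M S P" "u \<in> Sobolev_space M S P" using u v F A by auto
      have "(\<integral>\<^sup>+x. ennreal ((\<bar>real_of_ereal (u x - v x)\<bar> / (L * \<tau>)) powr q x) \<partial>M) =
        (\<integral>\<^sup>+x. ennreal ((\<bar>real_of_ereal (u x) / L - real_of_ereal (v x) / L\<bar> / \<tau>) powr q x) \<partial>M)"
        by (rule nn_integral_cong_AE, use diff(3)[OF uv] in eventually_elim)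
          (use L in \<open>simp add: diff_divide_distrib[symmetric] abs_divide\<close>)
      with le have "Lebesgue_norm M T (\<lambda>x. u x - v x) \<le> ennreal (L * \<tau>)"
        using L \<tau> by (intro Lebesgue_norm_le[OF diff(2)[OF uv] T]) auto
      also have "\<dots> \<le> ennreal r" using \<tau>L by (rule ennreal_leI)
      finally show "\<exists>v\<in>F. Lebesgue_norm M T (\<lambda>x. u x - v x) < \<epsilon>" using r v by (auto intro: le_less_trans)
    qed (use F in auto)
  qed
qed

end

section \<open>The compact embedding\<close>

theorem theorem3p6:
  fixes M :: "'a::metric_space measure"
    and Q p s q :: "'a \<Rightarrow> ereal"
  assumes "metric_measure_space M"
    and "totally_bounded (UNIV :: 'a set)"
    and "Q \<in> log_Holder_exponents M"
    and "lower_Ahlfors_regular M Q"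
    and "p \<in> log_Holder_exponents M"
    and "s \<in> log_Holder_exponents M"
    and "ess_less M (\<lambda>x. s x * p x) Q"
    and "q \<in> bounded_exponents M"
    and "AE x in M. p x \<le> q x"
    and "ess_less M q (\<lambda>x. Q x * p x / (Q x - s x * p x))"
  shows "compactly_embedded (Sobolev_space M s p) (Sobolev_norm M s p)
           (Lebesgue_space M q) (Lebesgue_norm M q)"
proof -
  have sets_M: "sets M = sets borel"
    and ball: "\<And>x r. r > 0 \<Longrightarrow> 0 < emeasure M (ball x r) \<and> emeasure M (ball x r) < \<infinity>"
    using assms(1) by (auto simp: metric_measure_space_def)
  have bdd: "Q \<in> bounded_exponents M" "p \<in> bounded_exponents M" "s \<in> bounded_exponents M"
    using assms(3,5,6) by (auto simp: log_Holder_exponents_def)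
  obtain lQ hQ where Qb: "0 < lQ" "AE x in M. ereal lQ \<le> Q x \<and> Q x \<le> ereal hQ"
    using bounded_exponents_AE_bounds[OF bdd(1)] by blast
  obtain lp hp where pb: "0 < lp" "AE x in M. ereal lp \<le> p x \<and> p x \<le> ereal hp"
    using bounded_exponents_AE_bounds[OF bdd(2)] by blast
  obtain ls hs where sb: "0 < ls" "AE x in M. ereal ls \<le> s x \<and> s x \<le> ereal hs"
    using bounded_exponents_AE_bounds[OF bdd(3)] by blast
  obtain lq hq where qb: "0 < lq" "AE x in M. ereal lq \<le> q x \<and> q x \<le> ereal hq"
    using bounded_exponents_AE_bounds[OF assms(8)] by blast
  define lo where "lo = Min {1, lQ, lp, ls, lq}"
  define hi where "hi = Max {1, hQ, hp, hs, hq}"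
  have lo: "0 < lo" "lo \<le> 1" "lo \<le> lQ" "lo \<le> lp" "lo \<le> ls" "lo \<le> lq"
    unfolding lo_def using Qb(1) pb(1) sb(1) qb(1) by auto
  have hi: "1 \<le> hi" "hQ \<le> hi" "hp \<le> hi" "hs \<le> hi" "hq \<le> hi"
    unfolding hi_def by auto
  obtain \<delta>1 where \<delta>1: "0 < \<delta>1" "AE x in M. ereal \<delta>1 \<le> Q x - s x * p x"
    using assms(7) AE_positive_lower_bound[of M "\<lambda>x. Q x - s x * p x"] by (auto simp: ess_less_def)
  obtain \<delta>2 where \<delta>2: "0 < \<delta>2" "AE x in M. ereal \<delta>2 \<le> Q x * p x / (Q x - s x * p x) - q x"
    using assms(10) AE_positive_lower_bound[of M "\<lambda>x. Q x * p x / (Q x - s x * p x) - q x"]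
    by (auto simp: ess_less_def)
  \<comment> \<open>Clearing the denominator \<open>Q - s * p \<ge> \<delta>1\<close> turns the gap \<open>\<delta>2\<close> into \<open>\<delta>1 * \<delta>2\<close>.\<close>
  define \<delta> where "\<delta> = min \<delta>1 (\<delta>1 * \<delta>2)"
  define Qr where "Qr x = real_of_ereal (Q x)" for x
  define pr where "pr x = real_of_ereal (p x)" for x
  define sr where "sr x = real_of_ereal (s x)" for x
  define qr where "qr x = real_of_ereal (q x)" for x
  define G where "G = {x. (Q x = ereal (Qr x) \<and> p x = ereal (pr x) \<and> s x = ereal (sr x) \<and> q x = ereal (qr x)) \<and>
    (pr x \<in> {lo..hi} \<and> sr x \<in> {lo..hi} \<and> Qr x \<in> {lo..hi} \<and> qr x \<in> {lo..hi}) \<and>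
    sr x * pr x + \<delta> \<le> Qr x \<and> qr x * (Qr x - sr x * pr x) + \<delta> \<le> Qr x * pr x}"
  have AE_G: "AE x in M. x \<in> G"
    using Qb(2) pb(2) sb(2) qb(2) \<delta>1(2) \<delta>2(2)
  proof eventually_elim
    case (elim x)
    have real: "\<exists>r. y = ereal r \<and> l \<le> r \<and> r \<le> h" if "ereal l \<le> y \<and> y \<le> ereal h" for y l h
      using that by (cases y) auto
    obtain a where a: "Q x = ereal a" "lQ \<le> a" "a \<le> hQ" using real[OF elim(1)] by blast
    obtain b where b: "p x = ereal b" "lp \<le> b" "b \<le> hp" using real[OF elim(2)] by blast
    obtain c where c: "s x = ereal c" "ls \<le> c" "c \<le> hs" using real[OF elim(3)] by blast
    obtain d where d: "q x = ereal d" "lq \<le> d" "d \<le> hq" using real[OF elim(4)] by blast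
    have 1: "\<delta>1 \<le> a - c * b" using elim(5) by (simp add: a b c)
    with \<delta>1 have pos: "0 < a - c * b" by linarith
    have "\<delta>2 \<le> a * b / (a - c * b) - d" using elim(6) pos by (simp add: a b c d)
    then have "\<delta>2 * (a - c * b) \<le> (a * b / (a - c * b) - d) * (a - c * b)"
      using pos by (intro mult_right_mono) auto
    also have "\<dots> = a * b - d * (a - c * b)" using pos by (simp add: left_diff_distrib)
    finally have 2: "d * (a - c * b) + \<delta>2 * (a - c * b) \<le> a * b" by linarith
    have "\<delta>1 * \<delta>2 \<le> \<delta>2 * (a - c * b)"
      using 1 \<delta>2(1) by (simp add: mult.commute mult_left_mono)
    then have "d * (a - c * b) + \<delta> \<le> a * b" "c * b + \<delta> \<le> a"
      using 1 2 unfolding \<delta>_def by linarith+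
    then show ?case
      using a b c d lo hi by (simp add: G_def Qr_def pr_def sr_def qr_def)
  qed
  have uc: "\<exists>r>0. \<forall>x\<in>G. \<forall>y\<in>G. dist x y < r \<longrightarrow> \<bar>real_of_ereal (f x) - real_of_ereal (f y)\<bar> < e"
    if f: "f \<in> log_Holder_exponents M" and e: "e > 0"
      and fG: "\<And>x. x \<in> G \<Longrightarrow> f x = ereal (real_of_ereal (f x)) \<and> real_of_ereal (f x) \<in> {lo..hi}" for f e
  proof -
    obtain C where C: "C > 0" "\<And>x y. \<bar>1 / f x - 1 / f y\<bar> \<le> ereal (C / ln (exp 1 + 1 / dist x y))"
      using f unfolding log_Holder_exponents_def by auto
    show ?thesis
    proof (rule log_Holder_uniformly_continuous[OF _ _ e C(1), of _ _ hi])
      show bd: "0 < real_of_ereal (f x) \<and> real_of_ereal (f x) \<le> hi" if "x \<in> G" for x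
        using fG[OF that] lo by auto
      show "\<bar>1 / real_of_ereal (f x) - 1 / real_of_ereal (f y)\<bar> \<le> C / ln (exp 1 + 1 / dist x y)"
        if "x \<in> G" "y \<in> G" for x y
      proof -
        note fx = fG[OF that(1)] and fy = fG[OF that(2)]
        obtain a b where ab: "f x = ereal a" "f y = ereal b" using fx fy by blast
        have "a \<noteq> 0" "b \<noteq> 0" using bd[OF that(1)] bd[OF that(2)] ab by auto
        then show ?thesis using C(2)[of x y] ab by (simp add: one_ereal_def)
      qed
    qed
  qed
  obtain b where b: "b > 0" "\<And>x r. r \<in> {0<..1} \<Longrightarrow>
      ereal b * epowr (ereal r) (Q x) \<le> enn2ereal (emeasure M (ball x r))"
    using assms(4) unfolding lower_Ahlfors_regular_def by blast
  interpret subcritical_exponents M pr sr Qr qr G lo hi "min b 1" \<delta>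
  proof
    show "sets M = sets borel" by (rule sets_M)
    show "r > 0 \<Longrightarrow> 0 < emeasure M (ball x r)" for x r using ball by blast
    show "totally_bounded (UNIV :: 'a set)" by fact
    show "emeasure M UNIV < \<infinity>"
    proof -
      obtain R where R: "\<And>x y :: 'a. dist x y \<le> R"
        using totally_bounded_UNIV_diameter[OF assms(2)] by blast
      have "(UNIV :: 'a set) = ball undefined (max 0 R + 1)"
      proof (intro equalityI subsetI)
        show "y \<in> ball undefined (max 0 R + 1)" for y :: 'a
          using R[of undefined y] by simp
      qed simp
      then show ?thesis using ball[of "max 0 R + 1" undefined] by simp
    qed
    show "pr \<in> borel_measurable M"
      using bdd(2) unfolding pr_def[abs_def] by (auto simp: bounded_exponents_def exponents_def)
    show "AE x in M. x \<in> G" by (rule AE_G)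
    show "0 < lo" "lo \<le> 1" "1 \<le> hi" using lo hi by auto
    show "0 < min b 1" "min b 1 \<le> 1" using b by auto
    show "0 < \<delta>" unfolding \<delta>_def using \<delta>1 \<delta>2 by simp
    show "pr x \<in> {lo..hi} \<and> sr x \<in> {lo..hi} \<and> Qr x \<in> {lo..hi} \<and> qr x \<in> {lo..hi}" if "x \<in> G" for x
      using that unfolding G_def by blast
    show "sr x * pr x + \<delta> \<le> Qr x" "qr x * (Qr x - sr x * pr x) + \<delta> \<le> Qr x * pr x" if "x \<in> G" for x
      using that unfolding G_def by blast+
    show "\<exists>r>0. \<forall>x\<in>G. \<forall>y\<in>G. dist x y < r \<longrightarrow>
         \<bar>pr x - pr y\<bar> < e \<and> \<bar>sr x - sr y\<bar> < e \<and> \<bar>Qr x - Qr y\<bar> < e" if e: "e > 0" for e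
    proof -
      obtain r1 where r1: "r1 > 0" "\<forall>x\<in>G. \<forall>y\<in>G. dist x y < r1 \<longrightarrow> \<bar>pr x - pr y\<bar> < e"
        using uc[OF assms(5) e] unfolding G_def pr_def by auto
      obtain r2 where r2: "r2 > 0" "\<forall>x\<in>G. \<forall>y\<in>G. dist x y < r2 \<longrightarrow> \<bar>sr x - sr y\<bar> < e"
        using uc[OF assms(6) e] unfolding G_def sr_def by auto
      obtain r3 where r3: "r3 > 0" "\<forall>x\<in>G. \<forall>y\<in>G. dist x y < r3 \<longrightarrow> \<bar>Qr x - Qr y\<bar> < e"
        using uc[OF assms(3) e] unfolding G_def Qr_def by auto
      show ?thesis
        using r1 r2 r3 by (intro exI[of _ "min r1 (min r2 r3)"]) auto
    qed
    show "ennreal (min b 1 * r powr Qr x) \<le> emeasure M (ball x r)"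
      if "x \<in> G" "0 < r" "r \<le> 1" for x r
    proof -
      have "Q x = ereal (Qr x)" using that(1) unfolding G_def by blast
      then have "ereal (b * r powr Qr x) \<le> enn2ereal (emeasure M (ball x r))"
        using b(2)[of r x] that by (simp add: epowr_def)
      then have "e2ennreal (ereal (b * r powr Qr x)) \<le> e2ennreal (enn2ereal (emeasure M (ball x r)))"
        by (rule e2ennreal_mono)
      then have "ennreal (b * r powr Qr x) \<le> emeasure M (ball x r)" by simp
      moreover have "ennreal (min b 1 * r powr Qr x) \<le> ennreal (b * r powr Qr x)"
        by (intro ennreal_leI mult_right_mono) auto
      ultimately show ?thesis by simp
    qed
  qed
  show ?thesis
    by (rule compact_embedding) (use AE_G in \<open>eventually_elim, simp add: G_def\<close>)+
qed

end
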